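(* Let $G$ be a second countable étale essentially principal groupoid whose unit space $G^{(0)}$ is compact and totally disconnected, and suppose $G$ is almost finite. Then the index map $I:[[G]]\to H_1(G)$ is surjective.
   Context: An étale groupoid is a locally compact Hausdorff groupoid whose range map $r$ is a local homeomorphism; $s$ is the source map. $G$ is essentially principal if the interior of $\{g\in G: r(g)=s(g)\}$ equals $G^{(0)}$. A $G$-set is a subset $U$ with $r|_U,s|_U$ injective; $\tau_U=r\circ(s|_U)^{-1}$. $[[G]]$ is the group of homeomorphisms of $G^{(0)}$ of the form $\tau_U$ for a compact open $G$-set $U$; by essential principality such $U$ is unique. Homology: let $G^{(1)}=G$, $G^{(2)}=\{(g_1,g_2): s(g_1)=r(g_2)\}$; for a local homeomorphism $\pi:X\to Y$, $\pi_*:C_c(X,\mathbb{Z})\to C_c(Y,\mathbb{Z})$, $\pi_*(f)(y)=\sum_{\pi(x)=y}f(x)$. Put $\delta_1=s_*-r_*:C_c(G,\mathbb{Z})\to C(G^{(0)},\mathbb{Z})$ and $\delta_2=d_{0*}-d_{1*}+d_{2*}:C_c(G^{(2)},\mathbb{Z})\to C_c(G,\mathbb{Z})$ where $d_0(g_1,g_2)=g_2$, $d_1(g_1,g_2)=g_1g_2$, $d_2(g_1,g_2)=g_1$; $H_1(G)=\ker\delta_1/\operatorname{Im}\delta_2$. The index map is $I(\tau_U)=[1_U]\in H_1(G)$ (a homomorphism). Elementary subgroupoid: compact open principal subgroupoid $K$ with $K^{(0)}=G^{(0)}$. $G$ is almost finite if for every compact $C\subset G$ and $\varepsilon>0$ there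 is an elementary subgroupoid $K$ with $|CKx\setminus Kx|/|K(x)|<\varepsilon$ for all $x\in G^{(0)}$, where $Kx=\{k\in K: s(k)=x\}$, $CKx=\{ck:c\in C,k\in Kx,s(c)=r(k)\}$, $K(x)=r(Kx)$. *)

theory Defs
  imports "HOL-Analysis.Analysis"
begin

text \<open>A topological groupoid, with units identified with identity arrows.\<close>
record 'a groupoid =
  gcarr :: "'a set"
  grng :: "'a \<Rightarrow> 'a"
  gsrc :: "'a \<Rightarrow> 'a"
  gmul :: "'a \<Rightarrow> 'a \<Rightarrow> 'a"
  ginv :: "'a \<Rightarrow> 'a"
  gtop :: "'a topology"

definition units :: "'a groupoid \<Rightarrow> 'a set" where
  "units G = grng G ` gcarr G"

definition composable :: "'a groupoid \<Rightarrow> ('a \<times> 'a) set" where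
  "composable G = {(g, h). g \<in> gcarr G \<and> h \<in> gcarr G \<and> gsrc G g = grng G h}"

definition composable_top :: "'a groupoid \<Rightarrow> ('a \<times> 'a) topology" where
  "composable_top G = subtopology (prod_topology (gtop G) (gtop G)) (composable G)"

definition unit_top :: "'a groupoid \<Rightarrow> 'a topology" where
  "unit_top G = subtopology (gtop G) (units G)"

definition is_groupoid :: "'a groupoid \<Rightarrow> bool" where
  "is_groupoid G \<longleftrightarrow>
     (\<forall>g\<in>gcarr G. grng G g \<in> gcarr G \<and> gsrc G g \<in> gcarr G \<and> ginv G g \<in> gcarr G) \<and>
     (\<forall>g\<in>gcarr G. grng G (grng G g) = grng G g \<and> gsrc G (grng G g) = grng G g \<and>
                   grng G (gsrc G g) = gsrc G g \<and> gsrc G (gsrc G g) = gsrc G g) \<and>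
     (\<forall>(g, h)\<in>composable G. gmul G g h \<in> gcarr G \<and>
          grng G (gmul G g h) = grng G g \<and> gsrc G (gmul G g h) = gsrc G h) \<and>
     (\<forall>g\<in>gcarr G. \<forall>h\<in>gcarr G. \<forall>k\<in>gcarr G. gsrc G g = grng G h \<longrightarrow> gsrc G h = grng G k \<longrightarrow>
          gmul G (gmul G g h) k = gmul G g (gmul G h k)) \<and>
     (\<forall>g\<in>gcarr G. gmul G (grng G g) g = g \<and> gmul G g (gsrc G g) = g) \<and>
     (\<forall>g\<in>gcarr G. grng G (ginv G g) = gsrc G g \<and> gsrc G (ginv G g) = grng G g \<and>
          gmul G g (ginv G g) = grng G g \<and> gmul G (ginv G g) g = gsrc G g)"

definition local_homeomorphism :: "'a topology \<Rightarrow> 'b topology \<Rightarrow> ('a \<Rightarrow> 'b) \<Rightarrow> bool" where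
  "local_homeomorphism X Y f \<longleftrightarrow> continuous_map X Y f \<and>
     (\<forall>x\<in>topspace X. \<exists>U. openin X U \<and> x \<in> U \<and> openin Y (f ` U) \<and>
        homeomorphic_map (subtopology X U) (subtopology Y (f ` U)) f)"

definition etale_groupoid :: "'a groupoid \<Rightarrow> bool" where
  "etale_groupoid G \<longleftrightarrow> is_groupoid G \<and> topspace (gtop G) = gcarr G \<and>
     Hausdorff_space (gtop G) \<and> locally_compact_space (gtop G) \<and>
     continuous_map (composable_top G) (gtop G) (\<lambda>(g, h). gmul G g h) \<and>
     continuous_map (gtop G) (gtop G) (ginv G) \<and>
     continuous_map (gtop G) (unit_top G) (gsrc G) \<and>
     local_homeomorphism (gtop G) (unit_top G) (grng G)"

definition totally_disconnected_space :: "'a topology \<Rightarrow> bool" where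
  "totally_disconnected_space X \<longleftrightarrow>
     (\<forall>C. connectedin X C \<longrightarrow> (\<exists>x. C \<subseteq> {x}))"

definition essentially_principal :: "'a groupoid \<Rightarrow> bool" where
  "essentially_principal G \<longleftrightarrow>
     (gtop G) interior_of {g \<in> gcarr G. grng G g = gsrc G g} = units G"

definition G_set :: "'a groupoid \<Rightarrow> 'a set \<Rightarrow> bool" where
  "G_set G U \<longleftrightarrow> U \<subseteq> gcarr G \<and> inj_on (grng G) U \<and> inj_on (gsrc G) U"

text \<open>Compact open G-sets U for which tau_U is a homeomorphism of the whole unit space,
  i.e. the sets U with tau_U in the topological full group [[G]].\<close>
definition full_bisections :: "'a groupoid \<Rightarrow> 'a set set" where
  "full_bisections G = {U. G_set G U \<and> compactin (gtop G) U \<and> openin (gtop G) U \<and>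
       grng G ` U = units G \<and> gsrc G ` U = units G}"

definition tau :: "'a groupoid \<Rightarrow> 'a set \<Rightarrow> 'a \<Rightarrow> 'a" where
  "tau G U = grng G \<circ> the_inv_into U (gsrc G)"

definition full_group :: "'a groupoid \<Rightarrow> ('a \<Rightarrow> 'a) set" where
  "full_group G = {restrict (tau G U) (units G) | U. U \<in> full_bisections G}"

text \<open>C_c(X, Z): continuous (= locally constant) integer-valued functions with compact
  support; normalised to vanish outside the space.\<close>
definition Cc :: "'a topology \<Rightarrow> ('a \<Rightarrow> int) set" where
  "Cc X = {f. (\<forall>x\<in>topspace X. \<exists>V. openin X V \<and> x \<in> V \<and> (\<forall>y\<in>V. f y = f x)) \<and>
              compactin X (X closure_of {x \<in> topspace X. f x \<noteq> 0}) \<and>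
              (\<forall>x. x \<notin> topspace X \<longrightarrow> f x = 0)}"

definition push :: "'a topology \<Rightarrow> ('a \<Rightarrow> 'b) \<Rightarrow> ('a \<Rightarrow> int) \<Rightarrow> 'b \<Rightarrow> int" where
  "push X p f y = (\<Sum>x\<in>{x \<in> topspace X. p x = y \<and> f x \<noteq> 0}. f x)"

definition delta1 :: "'a groupoid \<Rightarrow> ('a \<Rightarrow> int) \<Rightarrow> 'a \<Rightarrow> int" where
  "delta1 G f = (\<lambda>x. push (gtop G) (gsrc G) f x - push (gtop G) (grng G) f x)"

definition delta2 :: "'a groupoid \<Rightarrow> ('a \<times> 'a \<Rightarrow> int) \<Rightarrow> 'a \<Rightarrow> int" where
  "delta2 G F = (\<lambda>g. push (composable_top G) snd F g
                     - push (composable_top G) (\<lambda>(g1, g2). gmul G g1 g2) F g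
                     + push (composable_top G) fst F g)"

definition cycles1 :: "'a groupoid \<Rightarrow> ('a \<Rightarrow> int) set" where
  "cycles1 G = {f \<in> Cc (gtop G). \<forall>x \<in> units G. delta1 G f x = 0}"

definition boundaries1 :: "'a groupoid \<Rightarrow> ('a \<Rightarrow> int) set" where
  "boundaries1 G = delta2 G ` Cc (composable_top G)"

definition hclass :: "'a groupoid \<Rightarrow> ('a \<Rightarrow> int) \<Rightarrow> ('a \<Rightarrow> int) set" where
  "hclass G f = {(\<lambda>x. f x + b x) | b. b \<in> boundaries1 G}"

definition H1 :: "'a groupoid \<Rightarrow> ('a \<Rightarrow> int) set set" where
  "H1 G = hclass G ` cycles1 G"

text \<open>Index map: I(tau_U) = [1_U], U the (unique, by essential principality) compact open
  G-set inducing the given element of the full group.\<close>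
definition index_map :: "'a groupoid \<Rightarrow> ('a \<Rightarrow> 'a) \<Rightarrow> ('a \<Rightarrow> int) set" where
  "index_map G \<phi> = hclass G (indicator (THE U. U \<in> full_bisections G \<and>
                                          restrict (tau G U) (units G) = \<phi>))"

definition elementary_subgroupoid :: "'a groupoid \<Rightarrow> 'a set \<Rightarrow> bool" where
  "elementary_subgroupoid G K \<longleftrightarrow>
     K \<subseteq> gcarr G \<and> compactin (gtop G) K \<and> openin (gtop G) K \<and>
     units G \<subseteq> K \<and>
     (\<forall>k\<in>K. ginv G k \<in> K) \<and>
     (\<forall>k\<in>K. \<forall>l\<in>K. gsrc G k = grng G l \<longrightarrow> gmul G k l \<in> K) \<and>
     (\<forall>k\<in>K. grng G k = gsrc G k \<longrightarrow> k \<in> units G)"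

definition almost_finite :: "'a groupoid \<Rightarrow> bool" where
  "almost_finite G \<longleftrightarrow>
     (\<forall>C \<epsilon>. compactin (gtop G) C \<and> \<epsilon> > (0::real) \<longrightarrow>
        (\<exists>K. elementary_subgroupoid G K \<and>
           (\<forall>x\<in>units G.
              let Kx = {k \<in> K. gsrc G k = x};
                  CKx = {gmul G c k | c k. c \<in> C \<and> k \<in> Kx \<and> gsrc G c = grng G k}
              in real (card (CKx - Kx)) / real (card (grng G ` Kx)) < \<epsilon>)))"

end

theory Submission
  imports Defs
begin

text \<open>
  A cycle is homologous to a sum of indicators of compact open bisections \<open>C\<^sub>i\<close>, since
  \<open>-[1\<^sub>C] = [1\<^sub>D]\<close> for \<open>D = C\<^sup>-\<^sup>1\<close>. Almost finiteness gives an elementary subgroupoid \<open>K\<close> such that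
  the parts \<open>E\<^sub>i = C\<^sub>i - K\<close> have, in every \<open>K\<close>-orbit, fewer source points (counted with
  multiplicity) than the orbit has elements; the cycle condition gives equally many range points.
  Hence bisections inside \<open>K\<close> move the sources of the \<open>E\<^sub>i\<close> to pairwise disjoint sets, and
  likewise the ranges, and a further bisection inside \<open>K\<close> matches the complements. Composing,
  one obtains a full bisection \<open>U\<close> such that \<open>1\<^sub>U\<close> differs from the given cycle, up to boundaries,
  by a cycle supported on \<open>K\<close>; such cycles are boundaries because \<open>K\<close> is principal with finite
  orbits and admits a clopen transversal.
\<close>

section \<open>Compact open sets\<close>

text \<open>The sets \<open>E i\<close> cannot simply be united: their sources overlap and so do
  their ranges, whereas a full bisection must hit every unit exactly once on each side. Arrows of
  \<open>K\<close> can spread them out because moving a set by a bisection inside \<open>K\<close>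
  preserves its count in every orbit, and any two points of an orbit are joined inside
  \<open>K\<close>. Cardinalities in orbits are therefore the only obstruction to matching. The
  price is that the correcting bisections are not cycles one at a time, so they cannot be discarded
  separately. Only the total discrepancy between the full bisection and the given sum is a cycle; it
  lives on \<open>K\<close>, where homology in degree one vanishes, and it also absorbs the parts of
  the \<open>C i\<close> that lie inside \<open>K\<close>.\<close>

definition compact_open :: "'a topology \<Rightarrow> 'a set \<Rightarrow> bool" where
  "compact_open X A \<longleftrightarrow> compactin X A \<and> openin X A"

lemma compact_open_empty: "compact_open X {}"
  by (simp add: compact_open_def)

lemma compact_open_Un: "compact_open X A \<Longrightarrow> compact_open X B \<Longrightarrow> compact_open X (A \<union> B)"
  by (auto simp: compact_open_def intro: compactin_Un)

lemma compact_open_UN: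
  "finite I \<Longrightarrow> (\<And>i. i \<in> I \<Longrightarrow> compact_open X (A i)) \<Longrightarrow> compact_open X (\<Union>i\<in>I. A i)"
  by (induction I rule: finite_induct) (auto simp: compact_open_empty intro: compact_open_Un)

lemma compact_open_subset: "compact_open X A \<Longrightarrow> A \<subseteq> topspace X"
  by (simp add: compact_open_def compactin_subset_topspace)

lemma compact_open_imp_closed: "Hausdorff_space X \<Longrightarrow> compact_open X A \<Longrightarrow> closedin X A"
  by (simp add: compact_open_def compactin_imp_closedin)

lemma compact_open_clopen_subset:
  "compact_open X A \<Longrightarrow> closedin X B \<Longrightarrow> openin X B \<Longrightarrow> B \<subseteq> A \<Longrightarrow> compact_open X B"
  by (auto simp: compact_open_def intro: closed_compactin)

lemma compact_open_Diff:
  "Hausdorff_space X \<Longrightarrow> compact_open X A \<Longrightarrow> compact_open X B \<Longrightarrow> compact_open X (A - B)"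
  by (rule compact_open_clopen_subset[of X A])
    (auto simp: compact_open_imp_closed closedin_diff openin_diff compact_open_def
      compactin_imp_closedin)

text \<open>In a compact Hausdorff space, two closed sets such that no connected set meets both are
  separated by a clopen set (\<open>cut_wire_fence_theorem\<close>). Here connected sets have at
  most one point, so \<open>x\<close> can be split off from the complement of
  \<open>W\<close>.\<close>

lemma compact_open_nbhd_base:
  assumes "compact_space X" "Hausdorff_space X" "totally_disconnected_space X"
    and "openin X W" "x \<in> W"
  obtains Z where "compact_open X Z" "x \<in> Z" "Z \<subseteq> W"
proof -
  have "separated_between X {x} (topspace X - W)"
  proof (rule cut_wire_fence_theorem)
    show "closedin X {x}"
      using assms by (meson Hausdorff_imp_t1_space closedin_t1_singleton openin_subset subsetD)
    show "disjnt C {x} \<or> disjnt C (topspace X - W)" if conn: "connectedin X C" for C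
    proof -
      obtain y where "C \<subseteq> {y}"
        using conn assms(3) unfolding totally_disconnected_space_def by metis
      then show ?thesis
        using assms(5) by (auto simp: disjnt_def)
    qed
  qed (use assms in auto)
  then obtain Z where Z: "closedin X Z" "openin X Z" "{x} \<subseteq> Z" "topspace X - W \<subseteq> topspace X - Z"
    by (auto simp: separated_between)
  show ?thesis
  proof
    show "compact_open X Z"
      using Z assms(1) by (simp add: closedin_compact_space compact_open_def)
  qed (use Z closedin_subset in auto)
qed

section \<open>Groupoid algebra and topology\<close>

locale ample_groupoid =
  fixes G :: "'a groupoid"
  assumes etale: "etale_groupoid G"
    and ess_principal: "essentially_principal G"
    and compact_units: "compact_space (unit_top G)"
    and disconnected_units: "totally_disconnected_space (unit_top G)"
begin

abbreviation "\<Gamma> \<equiv> gcarr G"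
abbreviation "\<T> \<equiv> gtop G"
abbreviation "\<rho> \<equiv> grng G"
abbreviation "\<sigma> \<equiv> gsrc G"
abbreviation "\<iota> \<equiv> ginv G"
abbreviation mult (infixl "\<odot>" 70) where "g \<odot> h \<equiv> gmul G g h"

section \<open>Algebraic identities for arrows and units\<close>

lemma groupoid: "is_groupoid G"
  using etale by (simp add: etale_groupoid_def)

lemma closed [simp]:
  "g \<in> \<Gamma> \<Longrightarrow> \<rho> g \<in> \<Gamma>" "g \<in> \<Gamma> \<Longrightarrow> \<sigma> g \<in> \<Gamma>" "g \<in> \<Gamma> \<Longrightarrow> \<iota> g \<in> \<Gamma>"
  "g \<in> \<Gamma> \<Longrightarrow> h \<in> \<Gamma> \<Longrightarrow> \<sigma> g = \<rho> h \<Longrightarrow> g \<odot> h \<in> \<Gamma>"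
  using groupoid by (auto simp: is_groupoid_def composable_def)

lemma rng_src [simp]:
  "g \<in> \<Gamma> \<Longrightarrow> \<rho> (\<rho> g) = \<rho> g" "g \<in> \<Gamma> \<Longrightarrow> \<sigma> (\<rho> g) = \<rho> g"
  "g \<in> \<Gamma> \<Longrightarrow> \<rho> (\<sigma> g) = \<sigma> g" "g \<in> \<Gamma> \<Longrightarrow> \<sigma> (\<sigma> g) = \<sigma> g"
  "g \<in> \<Gamma> \<Longrightarrow> h \<in> \<Gamma> \<Longrightarrow> \<sigma> g = \<rho> h \<Longrightarrow> \<rho> (g \<odot> h) = \<rho> g"
  "g \<in> \<Gamma> \<Longrightarrow> h \<in> \<Gamma> \<Longrightarrow> \<sigma> g = \<rho> h \<Longrightarrow> \<sigma> (g \<odot> h) = \<sigma> h"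
  "g \<in> \<Gamma> \<Longrightarrow> \<rho> (\<iota> g) = \<sigma> g" "g \<in> \<Gamma> \<Longrightarrow> \<sigma> (\<iota> g) = \<rho> g"
  using groupoid by (auto simp: is_groupoid_def composable_def)

lemma assoc:
  "g \<in> \<Gamma> \<Longrightarrow> h \<in> \<Gamma> \<Longrightarrow> k \<in> \<Gamma> \<Longrightarrow> \<sigma> g = \<rho> h \<Longrightarrow> \<sigma> h = \<rho> k \<Longrightarrow> g \<odot> h \<odot> k = g \<odot> (h \<odot> k)"
  using groupoid by (auto simp: is_groupoid_def)

lemma mult_simps [simp]:
  "g \<in> \<Gamma> \<Longrightarrow> \<rho> g \<odot> g = g" "g \<in> \<Gamma> \<Longrightarrow> g \<odot> \<sigma> g = g"
  "g \<in> \<Gamma> \<Longrightarrow> g \<odot> \<iota> g = \<rho> g" "g \<in> \<Gamma> \<Longrightarrow> \<iota> g \<odot> g = \<sigma> g"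
  using groupoid by (auto simp: is_groupoid_def)

lemma inv_mult_cancel [simp]:
  "g \<in> \<Gamma> \<Longrightarrow> h \<in> \<Gamma> \<Longrightarrow> \<sigma> g = \<rho> h \<Longrightarrow> \<iota> g \<odot> (g \<odot> h) = h"
  by (subst assoc[symmetric]) auto

lemma mult_inv_cancel [simp]:
  "g \<in> \<Gamma> \<Longrightarrow> h \<in> \<Gamma> \<Longrightarrow> \<rho> g = \<rho> h \<Longrightarrow> g \<odot> (\<iota> g \<odot> h) = h"
  by (subst assoc[symmetric]) auto

lemma mult_inv_cancel_right [simp]:
  "g \<in> \<Gamma> \<Longrightarrow> h \<in> \<Gamma> \<Longrightarrow> \<sigma> g = \<rho> h \<Longrightarrow> g \<odot> h \<odot> \<iota> h = g"
  by (subst assoc) (auto, metis mult_simps(2))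

lemma inv_mult_cancel_right [simp]:
  "g \<in> \<Gamma> \<Longrightarrow> h \<in> \<Gamma> \<Longrightarrow> \<sigma> g = \<sigma> h \<Longrightarrow> g \<odot> \<iota> h \<odot> h = g"
  by (subst assoc) (auto, metis mult_simps(2))

lemma inv_inv [simp]: "g \<in> \<Gamma> \<Longrightarrow> \<iota> (\<iota> g) = g"
  using inv_mult_cancel[of "\<iota> g" g] mult_simps(2)[of "\<iota> (\<iota> g)"] by simp

lemma units_iff: "x \<in> units G \<longleftrightarrow> x \<in> \<Gamma> \<and> \<rho> x = x"
proof
  show "x \<in> \<Gamma> \<and> \<rho> x = x" if "x \<in> units G"
    using that by (auto simp: units_def)
  show "x \<in> units G" if "x \<in> \<Gamma> \<and> \<rho> x = x"
    using that unfolding units_def by (metis image_eqI)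
qed

lemma rng_src_units [simp]: "g \<in> \<Gamma> \<Longrightarrow> \<rho> g \<in> units G" "g \<in> \<Gamma> \<Longrightarrow> \<sigma> g \<in> units G"
  by (auto simp: units_iff)

lemma units_subset: "units G \<subseteq> \<Gamma>"
  by (auto simp: units_iff)

lemma units_simps [simp]:
  assumes "x \<in> units G" shows "x \<in> \<Gamma>" "\<rho> x = x" "\<sigma> x = x" "\<iota> x = x"
proof -
  show 1: "x \<in> \<Gamma>" "\<rho> x = x"
    using assms by (auto simp: units_iff)
  then show 2: "\<sigma> x = x"
    by (metis rng_src(2))
  show "\<iota> x = x"
    using mult_simps(3)[OF 1(1)] mult_simps(1)[OF closed(3)[OF 1(1)]] 1 2 by simp
qed

text \<open>Equality of arrows with a common source is reduced to membership in the units, which is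
  what essential principality and the principality of subgroupoids deliver.\<close>

lemma eq_if_mult_inv_unit:
  assumes "g \<in> \<Gamma>" "h \<in> \<Gamma>" "\<sigma> g = \<sigma> h" "g \<odot> \<iota> h \<in> units G"
  shows "g = h"
proof -
  have "\<sigma> (g \<odot> \<iota> h) = \<rho> h"
    using assms(1-3) by simp
  then have "g \<odot> \<iota> h = \<rho> h"
    using units_simps(3)[OF assms(4)] by simp
  then show ?thesis
    using assms by (metis inv_mult_cancel_right mult_simps(1))
qed

section \<open>Topology of the unit space and of the structure maps\<close>

lemma topspace_eq [simp]: "topspace \<T> = \<Gamma>"
  using etale by (simp add: etale_groupoid_def)

lemma Hausdorff: "Hausdorff_space \<T>"
  using etale by (simp add: etale_groupoid_def)

lemma topspace_unit_top [simp]: "topspace (unit_top G) = units G"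
  using units_subset by (auto simp: unit_top_def)

text \<open>Essential principality exhibits the unit space as an interior. Open sets of units can
  therefore be handled in \<open>\<T>\<close> itself instead of \<open>unit_top G\<close>.\<close>

lemma openin_units: "openin \<T> (units G)"
  using ess_principal by (metis essentially_principal_def openin_interior_of)

lemma openin_unit_top: "openin (unit_top G) A \<longleftrightarrow> openin \<T> A \<and> A \<subseteq> units G"
  unfolding unit_top_def by (rule openin_open_subtopology[OF openin_units])

lemma compact_open_unit_top: "compact_open (unit_top G) A \<longleftrightarrow> compact_open \<T> A \<and> A \<subseteq> units G"
  by (auto simp: compact_open_def openin_unit_top) (auto simp: unit_top_def compactin_subtopology)

lemma compact_open_units: "compact_open \<T> (units G)"
  using compact_units compact_open_unit_top
  by (metis compact_open_def compact_space_def openin_topspace topspace_unit_top)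

lemma continuous_rng: "continuous_map \<T> \<T> \<rho>" and continuous_src: "continuous_map \<T> \<T> \<sigma>"
  and continuous_inv: "continuous_map \<T> \<T> \<iota>"
  using etale
  by (auto simp: etale_groupoid_def local_homeomorphism_def unit_top_def
      continuous_map_in_subtopology)

lemma continuous_mult:
  assumes "continuous_map X \<T> a" "continuous_map X \<T> b"
    and "\<And>x. x \<in> topspace X \<Longrightarrow> \<sigma> (a x) = \<rho> (b x)"
  shows "continuous_map X \<T> (\<lambda>x. a x \<odot> b x)"
proof -
  have "continuous_map X (composable_top G) (\<lambda>x. (a x, b x))"
    using assms continuous_map_image_subset_topspace[OF assms(1)]
      continuous_map_image_subset_topspace[OF assms(2)]
    by (auto simp: composable_top_def composable_def continuous_map_in_subtopology
        intro: continuous_map_pairedI)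
  moreover have "continuous_map (composable_top G) \<T> (\<lambda>(g, h). g \<odot> h)"
    using etale by (simp add: etale_groupoid_def)
  ultimately show ?thesis
    using continuous_map_compose by (fastforce simp: o_def)
qed

lemma rng_local_chart:
  assumes "g \<in> \<Gamma>"
  obtains U where "openin \<T> U" "g \<in> U" "inj_on \<rho> U" "\<And>W. openin \<T> W \<Longrightarrow> W \<subseteq> U \<Longrightarrow> openin \<T> (\<rho> ` W)"
proof -
  obtain U where U: "openin \<T> U" "g \<in> U" "openin (unit_top G) (\<rho> ` U)"
    "homeomorphic_map (subtopology \<T> U) (subtopology (unit_top G) (\<rho> ` U)) \<rho>"
    using etale assms by (auto simp: etale_groupoid_def local_homeomorphism_def)
  show ?thesis
  proof
    show "inj_on \<rho> U"
      using U(4) openin_subset[OF U(1)]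
      by (metis homeomorphic_imp_injective_map inf.absorb2 topspace_eq topspace_subtopology)
    show "openin \<T> (\<rho> ` W)" if "openin \<T> W" "W \<subseteq> U" for W
    proof -
      have "openin (subtopology \<T> U) W"
        using that U(1) by (simp add: openin_open_subtopology)
      then have "openin (subtopology (unit_top G) (\<rho> ` U)) (\<rho> ` W)"
        using U(4) by (metis homeomorphic_imp_open_map open_map_def)
      then show ?thesis
        using U(3) by (metis openin_open_subtopology openin_unit_top)
    qed
  qed (use U in auto)
qed

lemma openin_rng:
  assumes "openin \<T> W" shows "openin \<T> (\<rho> ` W)"
proof (subst openin_subopen, intro ballI)
  fix y assume "y \<in> \<rho> ` W"
  then obtain g where g: "g \<in> W" "y = \<rho> g" by auto
  then have "g \<in> \<Gamma>" using openin_subset[OF assms] by auto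
  then obtain U where U: "openin \<T> U" "g \<in> U"
    "\<And>W. openin \<T> W \<Longrightarrow> W \<subseteq> U \<Longrightarrow> openin \<T> (\<rho> ` W)" by (metis rng_local_chart)
  then show "\<exists>S. openin \<T> S \<and> y \<in> S \<and> S \<subseteq> \<rho> ` W"
    using g assms by (intro exI[of _ "\<rho> ` (U \<inter> W)"]) auto
qed

lemma inv_image_eq: "U \<subseteq> \<Gamma> \<Longrightarrow> \<iota> ` U = {g \<in> \<Gamma>. \<iota> g \<in> U}"
  by (auto simp: image_iff subset_iff) (metis inv_inv)

lemma openin_inv: "openin \<T> W \<Longrightarrow> openin \<T> (\<iota> ` W)"
  using openin_continuous_map_preimage[OF continuous_inv, of W] openin_subset[of \<T> W]
  by (simp add: inv_image_eq)

text \<open>Being a local homeomorphism is stated for the range map; inversion carries its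
  consequences over to the source map.\<close>

lemma src_image_eq: "U \<subseteq> \<Gamma> \<Longrightarrow> \<sigma> ` U = \<rho> ` \<iota> ` U"
  by (force simp: image_iff subset_iff)

lemma openin_src: "openin \<T> W \<Longrightarrow> openin \<T> (\<sigma> ` W)"
  using openin_rng openin_inv openin_subset[of \<T> W] by (simp add: src_image_eq)

section \<open>Compact open bisections, whose source and range may be proper subsets of the unit
  space\<close>

definition bisection :: "'a set \<Rightarrow> bool" where
  "bisection U \<longleftrightarrow> G_set G U \<and> compact_open \<T> U"

lemma bisectionD:
  assumes "bisection U"
  shows "U \<subseteq> \<Gamma>" "inj_on \<rho> U" "inj_on \<sigma> U" "compact_open \<T> U" "compactin \<T> U" "openin \<T> U"
    "closedin \<T> U"
  using assms compact_open_imp_closed[OF Hausdorff]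
  by (auto simp: bisection_def G_set_def compact_open_def)

lemma bisection_subset: "bisection U \<Longrightarrow> compact_open \<T> V \<Longrightarrow> V \<subseteq> U \<Longrightarrow> bisection V"
  by (auto simp: bisection_def G_set_def inj_on_subset)

lemma bisection_Un:
  assumes "bisection U" "bisection V" "\<rho> ` U \<inter> \<rho> ` V = {}" "\<sigma> ` U \<inter> \<sigma> ` V = {}"
  shows "bisection (U \<union> V)"
  using assms by (auto simp: bisection_def G_set_def compact_open_Un inj_on_Un)

lemma bisection_empty: "bisection {}"
  by (auto simp: bisection_def G_set_def compact_open_empty)

lemma bisection_units_subset: "compact_open \<T> A \<Longrightarrow> A \<subseteq> units G \<Longrightarrow> bisection A"
  by (auto simp: bisection_def G_set_def inj_on_def subset_iff)

lemma compact_open_rng: "compact_open \<T> U \<Longrightarrow> compact_open \<T> (\<rho> ` U)"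
  by (simp add: compact_open_def openin_rng image_compactin[OF _ continuous_rng])

lemma compact_open_src: "compact_open \<T> U \<Longrightarrow> compact_open \<T> (\<sigma> ` U)"
  by (simp add: compact_open_def openin_src image_compactin[OF _ continuous_src])

lemma compact_open_restrict:
  assumes "compact_open \<T> U" "compact_open \<T> A"
  shows "compact_open \<T> {g \<in> U. \<rho> g \<in> A}" "compact_open \<T> {g \<in> U. \<sigma> g \<in> A}"
proof -
  have c: "closedin \<T> U" "closedin \<T> A" "openin \<T> U" "openin \<T> A"
    using assms compact_open_imp_closed[OF Hausdorff] by (auto simp: compact_open_def)
  have *: "compact_open \<T> (U \<inter> {g \<in> topspace \<T>. f g \<in> A})" if "continuous_map \<T> \<T> f" for f
    using that c
    by (intro compact_open_clopen_subset[OF assms(1)] closedin_Int openin_Int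
        closedin_continuous_map_preimage[OF that] openin_continuous_map_preimage[OF that]) auto
  have e: "U \<inter> {g \<in> topspace \<T>. f g \<in> A} = {g \<in> U. f g \<in> A}" for f
    using compact_open_subset[OF assms(1)] by auto
  show "compact_open \<T> {g \<in> U. \<rho> g \<in> A}" "compact_open \<T> {g \<in> U. \<sigma> g \<in> A}"
    using *[OF continuous_rng] *[OF continuous_src] unfolding e .
qed

text \<open>The preimage of an open \<open>V\<close> under the section is the range of
  \<open>U \<inter> V\<close>, which is open because the range map is open.\<close>

lemma continuous_rng_section:
  assumes "openin \<T> U" "inj_on \<rho> U"
  shows "continuous_map (subtopology \<T> (\<rho> ` U)) \<T> (the_inv_into U \<rho>)"
  unfolding continuous_map
proof (intro conjI allI impI)
  have sub: "U \<subseteq> \<Gamma>" "\<rho> ` U \<subseteq> \<Gamma>"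
    using openin_subset[OF assms(1)] by auto
  show "the_inv_into U \<rho> ` topspace (subtopology \<T> (\<rho> ` U)) \<subseteq> topspace \<T>"
    using sub assms(2) by (auto simp: the_inv_into_f_f)
  fix V assume V: "openin \<T> V"
  have "{x \<in> topspace (subtopology \<T> (\<rho> ` U)). the_inv_into U \<rho> x \<in> V} = \<rho> ` (U \<inter> V)"
    using sub assms(2) by (auto simp: the_inv_into_f_f)
  then show "openin (subtopology \<T> (\<rho> ` U)) {x \<in> topspace (subtopology \<T> (\<rho> ` U)). the_inv_into U \<rho> x \<in> V}"
    using openin_rng[OF openin_Int[OF assms(1) V]] openin_rng[OF assms(1)]
    by (auto simp: openin_open_subtopology)
qed

text \<open>A chart at \<open>g\<close> and the inverse of a chart at \<open>\<iota> g\<close> meet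
  in a set on which range and source are both injective. A compact open set of units inside its
  range is then lifted along the range section.\<close>

lemma bisection_nbhd_base:
  assumes "openin \<T> W" "g \<in> W"
  obtains U where "bisection U" "g \<in> U" "U \<subseteq> W"
proof -
  have g: "g \<in> \<Gamma>"
    using assms openin_subset by fastforce
  obtain A where A: "openin \<T> A" "g \<in> A" "inj_on \<rho> A"
    by (metis g rng_local_chart)
  obtain B where B: "openin \<T> B" "\<iota> g \<in> B" "inj_on \<rho> B"
    by (metis g closed(3) rng_local_chart)
  define O' where "O' = A \<inter> \<iota> ` B \<inter> W"
  have sub: "B \<subseteq> \<Gamma>" "A \<subseteq> \<Gamma>"
    using A B openin_subset by fastforce+
  have gB: "g \<in> \<iota> ` B"
    using B(2) inv_inv[OF g] by (metis image_eqI)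
  have O': "openin \<T> O'" "g \<in> O'" "inj_on \<rho> O'" "O' \<subseteq> \<Gamma>"
    using A B assms g sub
    by (auto simp: O'_def openin_inv gB intro!: openin_Int inj_on_subset[OF A(3)])
  have injs: "inj_on \<sigma> O'"
  proof (rule inj_onI)
    fix x y assume "x \<in> O'" "y \<in> O'" "\<sigma> x = \<sigma> y"
    moreover from this have "\<iota> x \<in> B" "\<iota> y \<in> B" "x \<in> \<Gamma>" "y \<in> \<Gamma>"
      using sub O'(4) unfolding O'_def by (auto simp: inv_image_eq)
    ultimately have "\<iota> x = \<iota> y"
      using inj_onD[OF B(3), of "\<iota> x" "\<iota> y"] by simp
    then show "x = y"
      using \<open>x \<in> O'\<close> \<open>y \<in> O'\<close> O'(4) by (metis inv_inv subsetD)
  qed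
  have "openin (unit_top G) (\<rho> ` O')"
    using O' openin_rng by (auto simp: openin_unit_top)
  moreover have "Hausdorff_space (unit_top G)"
    using Hausdorff by (simp add: unit_top_def Hausdorff_space_subtopology)
  ultimately obtain Z where Z: "compact_open \<T> Z" "\<rho> g \<in> Z" "Z \<subseteq> \<rho> ` O'" "Z \<subseteq> units G"
    using compact_open_nbhd_base[OF compact_units _ disconnected_units, of "\<rho> ` O'" "\<rho> g"] O'(2)
    by (metis compact_open_unit_top image_eqI)
  define U where "U = the_inv_into O' \<rho> ` Z"
  \<comment> \<open>Two descriptions of the lift are needed: as an image of \<open>Z\<close> under a
    continuous section it is compact, as part of a preimage of \<open>Z\<close> it is open.\<close>
  have U: "U = O' \<inter> {g \<in> topspace \<T>. \<rho> g \<in> Z}"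
  proof (intro equalityI subsetI)
    fix u assume "u \<in> U"
    then obtain z where z: "z \<in> Z" "u = the_inv_into O' \<rho> z"
      by (auto simp: U_def)
    then show "u \<in> O' \<inter> {g \<in> topspace \<T>. \<rho> g \<in> Z}"
      using Z(3) O'(4) f_the_inv_into_f[OF O'(3), of z] the_inv_into_into[OF O'(3), of z O'] by auto
  next
    fix u assume u: "u \<in> O' \<inter> {g \<in> topspace \<T>. \<rho> g \<in> Z}"
    then have "u = the_inv_into O' \<rho> (\<rho> u)"
      by (simp add: the_inv_into_f_f[OF O'(3)])
    then show "u \<in> U"
      using u unfolding U_def by blast
  qed
  have "compactin \<T> U"
    unfolding U_def using Z
    by (intro image_compactin[OF _ continuous_rng_section[OF O'(1,3)]])
      (auto simp: compactin_subtopology compact_open_def)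
  moreover have "openin \<T> U"
    unfolding U using Z O'(1) openin_continuous_map_preimage[OF continuous_rng]
    by (auto simp: compact_open_def)
  moreover have "G_set G U"
    using O' injs by (auto simp: U G_set_def inj_on_def)
  ultimately show thesis
    using that[of U] O' Z g by (auto simp: U bisection_def compact_open_def O'_def)
qed

text \<open>The open sets \<open>W g\<close> make the cover subordinate to a local condition, such
  as staying inside an open set or constancy of a function.\<close>

lemma compactin_bisection_cover:
  assumes "compactin \<T> C" and "\<And>g. g \<in> C \<Longrightarrow> openin \<T> (W g) \<and> g \<in> W g"
  obtains \<U> where "finite \<U>" "\<And>U. U \<in> \<U> \<Longrightarrow> bisection U \<and> (\<exists>g\<in>C. U \<subseteq> W g)" "C \<subseteq> \<Union>\<U>"
proof -
  define \<V> where "\<V> = {U. bisection U \<and> (\<exists>g\<in>C. U \<subseteq> W g)}"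
  have "C \<subseteq> \<Union>\<V>"
  proof
    fix g assume "g \<in> C"
    then obtain U where "bisection U" "g \<in> U" "U \<subseteq> W g"
      using assms(2)[OF \<open>g \<in> C\<close>] bisection_nbhd_base[of "W g" g] by blast
    then show "g \<in> \<Union>\<V>"
      using \<open>g \<in> C\<close> by (auto simp: \<V>_def)
  qed
  then show thesis
    using compactinD[OF assms(1), of \<V>] that by (auto simp: \<V>_def bisectionD(6) subset_iff)
qed

text \<open>Each of the finitely many bisections covering \<open>C\<close> meets a fibre of
  \<open>\<rho>\<close> or \<open>\<sigma>\<close> in at most one arrow.\<close>

lemma finite_fibre:
  assumes "compactin \<T> C"
  shows "finite {g \<in> C. \<rho> g = x}" "finite {g \<in> C. \<sigma> g = x}"
proof -
  obtain \<U> where U: "finite \<U>" "\<And>U. U \<in> \<U> \<Longrightarrow> bisection U" "C \<subseteq> \<Union>\<U>"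
    using compactin_bisection_cover[OF assms, of "\<lambda>_. \<Gamma>"] compactin_subset_topspace[OF assms]
    by (metis openin_topspace subsetD topspace_eq)
  have fin: "finite {g \<in> U. f g = x}" if "inj_on f U" for f :: "'a \<Rightarrow> 'a" and U
    by (rule inj_on_finite[OF inj_on_subset[OF that], of _ "{x}"]) auto
  show "finite {g \<in> C. \<rho> g = x}"
    by (rule finite_subset[of _ "\<Union>U\<in>\<U>. {g \<in> U. \<rho> g = x}"])
      (use U in \<open>auto intro!: fin bisectionD(2)\<close>)
  show "finite {g \<in> C. \<sigma> g = x}"
    by (rule finite_subset[of _ "\<Union>U\<in>\<U>. {g \<in> U. \<sigma> g = x}"])
      (use U in \<open>auto intro!: fin bisectionD(3)\<close>)
qed

lemma bisection_inv:
  assumes "bisection U" shows "bisection (\<iota> ` U)"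
proof -
  have "compact_open \<T> (\<iota> ` U)"
    using assms by (auto simp: compact_open_def openin_inv bisectionD
        intro: image_compactin[OF _ continuous_inv])
  then show ?thesis
    using bisectionD[OF assms] by (auto simp: bisection_def G_set_def inj_on_def subset_iff)
qed

lemma rng_src_inv_image: "U \<subseteq> \<Gamma> \<Longrightarrow> \<rho> ` \<iota> ` U = \<sigma> ` U" "U \<subseteq> \<Gamma> \<Longrightarrow> \<sigma> ` \<iota> ` U = \<rho> ` U"
  by (force simp: image_iff subset_iff)+

section \<open>Products of bisections\<close>

definition set_mult :: "'a set \<Rightarrow> 'a set \<Rightarrow> 'a set" (infixl "\<cdot>" 75) where
  "U \<cdot> V = {u \<odot> v | u v. u \<in> U \<and> v \<in> V \<and> \<sigma> u = \<rho> v}"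

text \<open>An equaliser of continuous maps into a Hausdorff space is closed; this is how
  compactness passes to sets of composable pairs.\<close>

lemma closedin_composable: "closedin (prod_topology \<T> \<T>) (composable G)"
proof -
  have "closedin (prod_topology \<T> \<T>) {p \<in> topspace (prod_topology \<T> \<T>). (\<sigma> \<circ> fst) p = (\<rho> \<circ> snd) p}"
    by (intro closedin_continuous_maps_eq[OF Hausdorff] continuous_map_compose[OF continuous_map_fst]
        continuous_map_compose[OF continuous_map_snd] continuous_src continuous_rng)
  also have "{p \<in> topspace (prod_topology \<T> \<T>). (\<sigma> \<circ> fst) p = (\<rho> \<circ> snd) p} = composable G"
    by (auto simp: composable_def)
  finally show ?thesis .
qed

lemma topspace_composable_top [simp]: "topspace (composable_top G) = composable G"
  by (auto simp: composable_top_def composable_def)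

lemma compactin_composable:
  assumes "compactin \<T> A" "compactin \<T> B"
  shows "compactin (composable_top G) (composable G \<inter> A \<times> B)"
  using assms closed_Int_compactin[OF closedin_composable, of "A \<times> B"]
  by (auto simp: composable_top_def compactin_subtopology compactin_Times)

text \<open>Compactness comes from the compact set of composable pairs. For openness, the left
  factor of a product is determined by the range of the product, so membership in
  \<open>U \<cdot> V\<close> becomes the open condition that the remaining factor lies in
  \<open>V\<close>.\<close>

lemma bisection_mult:
  assumes "bisection U" "bisection V" shows "bisection (U \<cdot> V)"
proof -
  note U = bisectionD[OF assms(1)] and V = bisectionD[OF assms(2)]
  have eq: "U \<cdot> V = (\<lambda>(g, h). g \<odot> h) ` (composable G \<inter> U \<times> V)"
    using U(1) V(1) by (auto simp: set_mult_def composable_def image_iff Bex_def) (blast+)?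
  have "compactin \<T> (U \<cdot> V)"
    unfolding eq using etale
    by (intro image_compactin[OF compactin_composable[OF U(5) V(5)]]) (simp add: etale_groupoid_def)
  moreover have "openin \<T> (U \<cdot> V)"
  proof -
    define D where "D = {g \<in> topspace \<T>. \<rho> g \<in> \<rho> ` U}"
    \<comment> \<open>\<open>q g\<close> is the only arrow of \<open>U\<close> with the same range
      as \<open>g\<close>, hence the only possible left factor of \<open>g\<close> from
      \<open>U\<close>.\<close>
    define q where "q = (\<lambda>g. the_inv_into U \<rho> (\<rho> g))"
    have q: "q g \<in> U" "\<rho> (q g) = \<rho> g" if "g \<in> D" for g
      using that U by (auto simp: D_def q_def f_the_inv_into_f[OF U(2)] the_inv_into_f_f[OF U(2)])
    have D: "openin \<T> D"
      unfolding D_def by (rule openin_continuous_map_preimage[OF continuous_rng openin_rng[OF U(6)]])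
    have topD: "topspace (subtopology \<T> D) = D"
      by (auto simp: D_def)
    have "continuous_map (subtopology \<T> D) (subtopology \<T> (\<rho> ` U)) \<rho>"
      using continuous_rng
      by (auto simp: continuous_map_in_subtopology continuous_map_from_subtopology D_def)
    then have "continuous_map (subtopology \<T> D) \<T> q"
      unfolding q_def using continuous_map_compose[OF _ continuous_rng_section[OF U(6,2)]]
      by (fastforce simp: o_def)
    then have "continuous_map (subtopology \<T> D) \<T> (\<lambda>g. \<iota> (q g) \<odot> g)"
      using q U(1) topD continuous_map_compose[OF _ continuous_inv]
      by (intro continuous_mult) (auto simp: o_def continuous_map_from_subtopology subset_iff)
    from openin_continuous_map_preimage[OF this V(6)]
    have "openin \<T> {g \<in> D. \<iota> (q g) \<odot> g \<in> V}"
      unfolding topD using D by (simp add: openin_open_subtopology)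
    also have "{g \<in> D. \<iota> (q g) \<odot> g \<in> V} = U \<cdot> V"
    proof (intro equalityI subsetI)
      fix g assume "g \<in> {g \<in> D. \<iota> (q g) \<odot> g \<in> V}"
      then have g: "g \<in> D" "g \<in> \<Gamma>" "\<iota> (q g) \<odot> g \<in> V" "q g \<in> \<Gamma>"
        using q U(1) by (auto simp: D_def)
      then have "g = q g \<odot> (\<iota> (q g) \<odot> g)" "\<sigma> (q g) = \<rho> (\<iota> (q g) \<odot> g)"
        using q by auto
      then show "g \<in> U \<cdot> V"
        using g q unfolding set_mult_def by blast
    next
      fix g assume "g \<in> U \<cdot> V"
      then obtain u v where uv: "g = u \<odot> v" "u \<in> U" "v \<in> V" "\<sigma> u = \<rho> v"
        by (auto simp: set_mult_def)
      then have "u \<in> \<Gamma>" "v \<in> \<Gamma>"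
        using U V by auto
      then have "g \<in> D" "q g = u"
        using uv U(2) by (auto simp: D_def q_def the_inv_into_f_f)
      then show "g \<in> {g \<in> D. \<iota> (q g) \<odot> g \<in> V}"
        using uv \<open>u \<in> \<Gamma>\<close> \<open>v \<in> \<Gamma>\<close> by simp
    qed
    finally show ?thesis .
  qed
  moreover have "G_set G (U \<cdot> V)"
    unfolding G_set_def
  proof (intro conjI)
    show "U \<cdot> V \<subseteq> \<Gamma>"
      using U(1) V(1) by (auto simp: set_mult_def subset_iff)
    \<comment> \<open>Either outer end fixes one factor, and the inner end of that factor fixes the
      other.\<close>
    have *: "u = u' \<and> v = v'" if "u \<in> U" "u' \<in> U" "v \<in> V" "v' \<in> V" "\<sigma> u = \<rho> v" "\<sigma> u' = \<rho> v'"
      "\<rho> u = \<rho> u' \<or> \<sigma> v = \<sigma> v'" for u u' v v'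
      using that U(2,3) V(2,3) by (metis inj_onD)
    show "inj_on \<rho> (U \<cdot> V)"
    proof (rule inj_onI)
      fix g h assume "g \<in> U \<cdot> V" "h \<in> U \<cdot> V" "\<rho> g = \<rho> h"
      then show "g = h"
        using U(1) V(1) unfolding set_mult_def by (clarsimp simp: subset_iff) (metis *)
    qed
    show "inj_on \<sigma> (U \<cdot> V)"
    proof (rule inj_onI)
      fix g h assume "g \<in> U \<cdot> V" "h \<in> U \<cdot> V" "\<sigma> g = \<sigma> h"
      then show "g = h"
        using U(1) V(1) unfolding set_mult_def by (clarsimp simp: subset_iff) (metis *)
    qed
  qed
  ultimately show ?thesis
    by (simp add: bisection_def compact_open_def)
qed

lemma rng_src_set_mult:
  assumes "U \<subseteq> \<Gamma>" "V \<subseteq> \<Gamma>" "\<sigma> ` U = \<rho> ` V"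
  shows "\<rho> ` (U \<cdot> V) = \<rho> ` U" "\<sigma> ` (U \<cdot> V) = \<sigma> ` V"
proof -
  have "\<exists>v\<in>V. \<sigma> u = \<rho> v" if "u \<in> U" for u using that assms(3) by (metis image_iff)
  then show "\<rho> ` (U \<cdot> V) = \<rho> ` U"
    using assms(1,2) by (fastforce simp: set_mult_def image_iff subset_iff)
  have "\<exists>u\<in>U. \<sigma> u = \<rho> v" if "v \<in> V" for v using that assms(3) by (metis image_iff)
  then show "\<sigma> ` (U \<cdot> V) = \<sigma> ` V"
    using assms(1,2) by (fastforce simp: set_mult_def image_iff subset_iff)
qed

section \<open>The full group through bisections, and well-definedness of the index map\<close>

lemma tau_eq:
  "bisection U \<Longrightarrow> u \<in> U \<Longrightarrow> tau G U (\<sigma> u) = \<rho> u"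
  by (simp add: tau_def the_inv_into_f_f bisectionD)

lemma full_bisections_iff:
  "U \<in> full_bisections G \<longleftrightarrow> bisection U \<and> \<rho> ` U = units G \<and> \<sigma> ` U = units G"
  by (auto simp: full_bisections_def bisection_def compact_open_def)

text \<open>If both sets induce the same map, the product of \<open>U\<close> with the inverse of
  \<open>V\<close> is open and consists of arrows with equal range and source, so essential
  principality puts it into the units. Exchanging the roles gives the uniqueness behind the index
  map.\<close>

lemma full_bisection_subset:
  assumes "U \<in> full_bisections G" "V \<in> full_bisections G"
    and eq: "restrict (tau G U) (units G) = restrict (tau G V) (units G)"
  shows "U \<subseteq> V"
proof
  have U: "bisection U" "\<sigma> ` U = units G" and V: "bisection V" "\<sigma> ` V = units G"
    using assms by (auto simp: full_bisections_iff)
  note UD = bisectionD[OF U(1)] and VD = bisectionD[OF V(1)]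
  have parallel: "\<rho> u = \<rho> v" if "u \<in> U" "v \<in> V" "\<sigma> u = \<sigma> v" for u v
    using that U V UD(1) by (metis eq restrict_apply' rng_src_units(2) subsetD tau_eq)
  have "U \<cdot> \<iota> ` V \<subseteq> {g \<in> \<Gamma>. \<rho> g = \<sigma> g}"
    using UD(1) VD(1) parallel by (auto simp: set_mult_def subset_iff)
  then have "U \<cdot> \<iota> ` V \<subseteq> units G"
    using bisectionD(6)[OF bisection_mult[OF U(1) bisection_inv[OF V(1)]]] ess_principal
    by (metis essentially_principal_def interior_of_maximal)
  moreover fix u assume u: "u \<in> U"
  moreover obtain v where v: "v \<in> V" "\<sigma> u = \<sigma> v"
    using u U(2) V(2) by (metis image_iff)
  moreover have "u \<odot> \<iota> v \<in> U \<cdot> \<iota> ` V"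
    using u v subsetD[OF VD(1) v(1)] unfolding set_mult_def
    by (intro CollectI exI[of _ u] exI[of _ "\<iota> v"]) simp
  ultimately have "u = v"
    using UD(1) VD(1) by (metis eq_if_mult_inv_unit subsetD)
  then show "u \<in> V"
    using v by simp
qed

lemma index_map_eq:
  assumes "U \<in> full_bisections G"
  shows "index_map G (restrict (tau G U) (units G)) = hclass G (indicator U)"
proof -
  have "(THE V. V \<in> full_bisections G \<and> restrict (tau G V) (units G) = restrict (tau G U) (units G)) = U"
    using assms by (intro the_equality) (auto intro: full_bisection_subset[THEN subsetD])
  then show ?thesis
    by (simp add: index_map_def)
qed

text \<open>After this the full group is handled only through its bisections.\<close>

lemma index_map_image: "index_map G ` full_group G = (\<lambda>U. hclass G (indicator U)) ` full_bisections G"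
  by (force simp: full_group_def index_map_eq image_iff)

end

section \<open>Compactly supported functions and push-forwards\<close>

text \<open>Any compact set outside which \<open>f\<close> vanishes will do: in a Hausdorff space it
  is closed, so it contains the closure that \<open>Cc\<close> refers to.\<close>

lemma CcI:
  assumes "Hausdorff_space X"
    and "\<And>x. x \<in> topspace X \<Longrightarrow> \<exists>V. openin X V \<and> x \<in> V \<and> (\<forall>y\<in>V. f y = f x)"
    and "compactin X C" "\<And>x. x \<notin> C \<Longrightarrow> f x = 0"
  shows "f \<in> Cc X"
proof -
  have "X closure_of {x \<in> topspace X. f x \<noteq> 0} \<subseteq> C"
    using assms by (intro closure_of_minimal compactin_imp_closedin) auto
  then have "compactin X (X closure_of {x \<in> topspace X. f x \<noteq> 0})"
    by (rule closed_compactin[OF assms(3) _ closedin_closure_of])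
  moreover have "f x = 0" if "x \<notin> topspace X" for x
    using assms(3,4) compactin_subset_topspace that by blast
  ultimately show ?thesis
    using assms(2) by (simp add: Cc_def)
qed

lemma CcE:
  assumes "f \<in> Cc X"
  obtains C where "compactin X C" "\<And>x. x \<notin> C \<Longrightarrow> f x = 0"
proof
  show "compactin X (X closure_of {x \<in> topspace X. f x \<noteq> 0})"
    using assms by (simp add: Cc_def)
  have "{x \<in> topspace X. f x \<noteq> 0} \<subseteq> X closure_of {x \<in> topspace X. f x \<noteq> 0}"
    by (rule closure_of_subset) auto
  then show "f x = 0" if "x \<notin> X closure_of {x \<in> topspace X. f x \<noteq> 0}" for x
    using that assms unfolding Cc_def by blast
qed

lemma Cc_locally_constant:
  "f \<in> Cc X \<Longrightarrow> x \<in> topspace X \<Longrightarrow> \<exists>V. openin X V \<and> x \<in> V \<and> (\<forall>y\<in>V. f y = f x)"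
  by (simp add: Cc_def)

text \<open>The condition \<open>h 0 0 = 0\<close> keeps the result supported in the union of the
  two supports. Sums, differences, negatives and multiples are all instances.\<close>

lemma Cc_combine:
  assumes "Hausdorff_space X" "f \<in> Cc X" "g \<in> Cc X" "h 0 0 = 0"
  shows "(\<lambda>x. h (f x) (g x)) \<in> Cc X"
proof -
  obtain C D where CD: "compactin X C" "\<And>x. x \<notin> C \<Longrightarrow> f x = 0" "compactin X D" "\<And>x. x \<notin> D \<Longrightarrow> g x = 0"
    using assms CcE by metis
  show ?thesis
  proof (rule CcI[OF assms(1), of _ "C \<union> D"])
    fix x assume x: "x \<in> topspace X"
    obtain V where "openin X V" "x \<in> V" "\<forall>y\<in>V. f y = f x"
      using Cc_locally_constant[OF assms(2) x] by blast
    moreover obtain W where "openin X W" "x \<in> W" "\<forall>y\<in>W. g y = g x"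
      using Cc_locally_constant[OF assms(3) x] by blast
    moreover from calculation have "\<forall>y\<in>V \<inter> W. h (f y) (g y) = h (f x) (g x)"
      by (metis IntD1 IntD2)
    ultimately show "\<exists>V. openin X V \<and> x \<in> V \<and> (\<forall>y\<in>V. h (f y) (g y) = h (f x) (g x))"
      by (intro exI[of _ "V \<inter> W"] conjI openin_Int IntI)
  qed (use CD assms(4) in \<open>auto intro: compactin_Un\<close>)
qed

lemma Cc_indicator:
  assumes "Hausdorff_space X" "compact_open X A"
  shows "indicator A \<in> Cc X"
proof (rule CcI[OF assms(1), of _ A])
  fix x assume x: "x \<in> topspace X"
  have "openin X A" "openin X (topspace X - A)"
    using assms compact_open_imp_closed[OF assms] by (auto simp: compact_open_def)
  then show "\<exists>V. openin X V \<and> x \<in> V \<and> (\<forall>y\<in>V. indicator A y = (indicator A x :: int))"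
    using x by (intro exI[of _ "if x \<in> A then A else topspace X - A"]) auto
qed (use assms in \<open>auto simp: compact_open_def\<close>)

lemma Cc_zero: "Hausdorff_space X \<Longrightarrow> (\<lambda>x. 0) \<in> Cc X"
  by (rule CcI[of _ _ "{}"]) auto

lemma Cc_sum:
  assumes "Hausdorff_space X" "\<And>i. i \<in> I \<Longrightarrow> f i \<in> Cc X"
  shows "(\<lambda>x. \<Sum>i\<in>I. f i x) \<in> Cc X"
  using assms(2)
  by (induction I rule: infinite_finite_induct)
    (auto simp: Cc_zero assms(1) intro!: Cc_combine[OF assms(1), where h = "(+)"])

text \<open>A sum over an infinite set is 0 in HOL, so additivity and functoriality of
  \<open>push\<close> need the support to have finite fibres.\<close>

definition finite_fibres :: "'a topology \<Rightarrow> ('a \<Rightarrow> 'b) \<Rightarrow> ('a \<Rightarrow> int) \<Rightarrow> bool" where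
  "finite_fibres X p f \<longleftrightarrow> (\<forall>y. finite {x \<in> topspace X. p x = y \<and> f x \<noteq> 0})"

text \<open>Allowing zeros of \<open>f\<close> in \<open>A\<close> lets several push-forwards be
  compared over one common finite set.\<close>

lemma push_eq_sum:
  assumes "finite A" "A \<subseteq> {x \<in> topspace X. p x = y}"
    and "\<And>x. x \<in> topspace X \<Longrightarrow> p x = y \<Longrightarrow> f x \<noteq> 0 \<Longrightarrow> x \<in> A"
  shows "push X p f y = sum f A"
  unfolding push_def using assms by (intro sum.mono_neutral_left) auto

lemma push_add:
  assumes "finite_fibres X p f" "finite_fibres X p g"
  shows "push X p (\<lambda>x. f x + g x) y = push X p f y + push X p g y"
proof -
  define A where "A = {x \<in> topspace X. p x = y \<and> f x \<noteq> 0} \<union> {x \<in> topspace X. p x = y \<and> g x \<noteq> 0}"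
  have "finite A"
    using assms by (auto simp: A_def finite_fibres_def)
  then have *: "push X p h y = sum h A" if "\<And>x. f x = 0 \<Longrightarrow> g x = 0 \<Longrightarrow> h x = 0" for h
    using that by (intro push_eq_sum) (auto simp: A_def)
  show ?thesis
    by (subst (1 2 3) *) (simp_all add: sum.distrib)
qed

lemma push_minus: "push X p (\<lambda>x. - f x) y = - push X p f y"
  by (simp add: push_def sum_negf)

lemma finite_fibres_minus: "finite_fibres X p (\<lambda>x. - f x) = finite_fibres X p f"
  by (simp add: finite_fibres_def)

lemma finite_fibres_add:
  assumes "finite_fibres X p f" "finite_fibres X p g"
  shows "finite_fibres X p (\<lambda>x. f x + g x)"
  unfolding finite_fibres_def
proof
  fix y
  show "finite {x \<in> topspace X. p x = y \<and> f x + g x \<noteq> 0}"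
    by (rule finite_subset[of _ "{x \<in> topspace X. p x = y \<and> f x \<noteq> 0} \<union> {x \<in> topspace X. p x = y \<and> g x \<noteq> 0}"])
      (use assms in \<open>auto simp: finite_fibres_def\<close>)
qed

lemma finite_fibres_coarser:
  assumes "finite_fibres X (\<lambda>x. q (p x)) F" shows "finite_fibres X p F"
  unfolding finite_fibres_def
proof
  fix y
  show "finite {x \<in> topspace X. p x = y \<and> F x \<noteq> 0}"
    by (rule finite_subset[of _ "{x \<in> topspace X. q (p x) = q y \<and> F x \<noteq> 0}"])
      (use assms in \<open>auto simp: finite_fibres_def\<close>)
qed

lemma finite_fibres_cong:
  "(\<And>x. x \<in> topspace X \<Longrightarrow> p x = q x) \<Longrightarrow> finite_fibres X p f = finite_fibres X q f"
  by (simp add: finite_fibres_def cong: conj_cong)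

lemma push_diff:
  assumes "finite_fibres X p f" "finite_fibres X p g"
  shows "push X p (\<lambda>x. f x - g x) y = push X p f y - push X p g y"
  using push_add[of X p f "\<lambda>x. - g x" y] assms by (simp add: push_minus finite_fibres_minus)

lemma finite_fibres_diff:
  assumes "finite_fibres X p f" "finite_fibres X p g"
  shows "finite_fibres X p (\<lambda>x. f x - g x)"
  using finite_fibres_add[of X p f "\<lambda>x. - g x"] assms by (simp add: finite_fibres_minus)

lemma push_nonzeroE:
  assumes "push X p f y \<noteq> 0"
  obtains x where "x \<in> topspace X" "p x = y" "f x \<noteq> 0"
  using assms unfolding push_def by (metis (mono_tags, lifting) mem_Collect_eq sum.not_neutral_contains_not_neutral)

text \<open>The fibre of the composite is regrouped along \<open>p\<close>. Cancellation may make
  \<open>push X p f\<close> vanish at some image points, so the outer sum runs over the whole image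
  of the support.\<close>

lemma push_comp:
  assumes fin: "finite_fibres X (\<lambda>x. q (p x)) f" and p: "\<And>x. x \<in> topspace X \<Longrightarrow> p x \<in> topspace Y"
  shows "push Y q (push X p f) y = push X (\<lambda>x. q (p x)) f y"
    and "finite_fibres Y q (push X p f)"
proof -
  define S where "S y = {x \<in> topspace X. q (p x) = y \<and> f x \<noteq> 0}" for y
  have finS: "finite (S y)" for y
    using fin by (auto simp: S_def finite_fibres_def)
  have mem: "z \<in> p ` S y" if "z \<in> topspace Y" "q z = y" "push X p f z \<noteq> 0" for z y
    using that by (auto simp: S_def elim!: push_nonzeroE)
  have "push Y q (push X p f) y = (\<Sum>z\<in>p ` S y. push X p f z)"
    using finS p mem by (intro push_eq_sum) (auto simp: S_def)
  also have "\<dots> = (\<Sum>z\<in>p ` S y. \<Sum>x\<in>{x \<in> S y. p x = z}. f x)"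
  proof (rule sum.cong[OF refl])
    fix z assume "z \<in> p ` S y"
    then have "{x \<in> S y. p x = z} = {x \<in> topspace X. p x = z \<and> f x \<noteq> 0}"
      by (auto simp: S_def)
    then show "push X p f z = (\<Sum>x\<in>{x \<in> S y. p x = z}. f x)"
      by (simp add: push_def)
  qed
  also have "\<dots> = (\<Sum>x\<in>S y. f x)"
    by (rule sum.image_gen[OF finS, symmetric])
  finally show "push Y q (push X p f) y = push X (\<lambda>x. q (p x)) f y"
    by (simp add: push_def S_def)
  show "finite_fibres Y q (push X p f)"
    unfolding finite_fibres_def
  proof
    fix y
    show "finite {z \<in> topspace Y. q z = y \<and> push X p f z \<noteq> 0}"
      by (rule finite_subset[of _ "p ` S y"]) (use mem finS in auto)
  qed
qed

lemma card_Int_image_Un: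
  assumes "finite O'" "inj_on p (A \<union> B)" "A \<inter> B = {}"
  shows "card (O' \<inter> p ` (A \<union> B)) = card (O' \<inter> p ` A) + card (O' \<inter> p ` B)"
proof -
  have "p ` A \<inter> p ` B = {}"
    using assms(2,3) by (simp add: inj_on_Un) blast
  then show ?thesis
    using assms(1) by (subst card_Un_disjoint[symmetric]) (auto simp: image_Un Int_Un_distrib)
qed

lemma card_Int_eq_sum_indicator:
  assumes "finite O'" shows "int (card (O' \<inter> A)) = (\<Sum>y\<in>O'. indicator A y)"
proof -
  have "(\<Sum>y\<in>O'. indicator A y :: int) = (\<Sum>y\<in>O' \<inter> A. 1)"
    using assms by (intro sum.mono_neutral_cong_right) (auto simp: indicator_def)
  then show ?thesis by simp
qed

lemma push_cong: "(\<And>x. x \<in> topspace X \<Longrightarrow> p x = q x) \<Longrightarrow> push X p = push X q"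
  by (auto simp: push_def fun_eq_iff intro!: sum.cong)

lemma push_indicator:
  assumes "inj_on p U" "U \<subseteq> topspace X"
  shows "push X p (indicator U) y = indicator (p ` U) y"
proof (cases "y \<in> p ` U")
  case True
  then obtain u where u: "u \<in> U" "y = p u" by auto
  then have "push X p (indicator U) y = sum (indicator U) {u}"
    using assms by (intro push_eq_sum) (auto simp: inj_on_def indicator_def split: if_splits)
  then show ?thesis
    using u by simp
next
  case False
  then have "push X p (indicator U) y = sum (indicator U) {}"
    by (intro push_eq_sum) (auto simp: indicator_def split: if_splits)
  then show ?thesis
    using False by simp
qed

section \<open>Homology of bisections\<close>

context ample_groupoid
begin

section \<open>The chain complex in low degrees\<close>

lemma Hausdorff_composable_top: "Hausdorff_space (composable_top G)"
  unfolding composable_top_def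
  by (intro Hausdorff_space_subtopology) (simp add: Hausdorff_space_prod_topology Hausdorff)

lemma Cc_finite_fibres:
  assumes "f \<in> Cc \<T>" shows "finite_fibres \<T> \<rho> f" "finite_fibres \<T> \<sigma> f"
proof -
  obtain C where C: "compactin \<T> C" "\<And>x. x \<notin> C \<Longrightarrow> f x = 0"
    using assms CcE by metis
  have "finite {x \<in> topspace \<T>. \<rho> x = y \<and> f x \<noteq> 0}" "finite {x \<in> topspace \<T>. \<sigma> x = y \<and> f x \<noteq> 0}" for y
    using C(2) by (blast intro: finite_subset[OF _ finite_fibre(1)[OF C(1), of y]]
        finite_subset[OF _ finite_fibre(2)[OF C(1), of y]])+
  then show "finite_fibres \<T> \<rho> f" "finite_fibres \<T> \<sigma> f"
    by (simp_all add: finite_fibres_def)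
qed

text \<open>A compact set carrying \<open>F\<close> projects to compact sets of arrows. Fixing a
  unit leaves finitely many choices for one entry, and each of these leaves finitely many for the
  other. The other composites of \<open>\<rho>\<close> and \<open>\<sigma>\<close> with the faces
  agree with these three on composable pairs.\<close>

lemma Cc_composable_finite_fibres:
  assumes "F \<in> Cc (composable_top G)"
  shows "finite_fibres (composable_top G) (\<lambda>p. \<rho> (fst p)) F"
    "finite_fibres (composable_top G) (\<lambda>p. \<sigma> (fst p)) F"
    "finite_fibres (composable_top G) (\<lambda>p. \<sigma> (snd p)) F"
proof -
  obtain C where C: "compactin (composable_top G) C" "\<And>x. x \<notin> C \<Longrightarrow> F x = 0"
    using assms CcE by metis
  have cont: "continuous_map (composable_top G) \<T> fst" "continuous_map (composable_top G) \<T> snd"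
    unfolding composable_top_def
    by (auto intro: continuous_map_from_subtopology continuous_map_fst continuous_map_snd)
  note A = finite_fibre[OF image_compactin[OF C(1) cont(1)]]
    and B = finite_fibre[OF image_compactin[OF C(1) cont(2)]]
  have mem: "g \<in> fst ` C" "h \<in> snd ` C" if "F (g, h) \<noteq> 0" for g h
    using C(2)[of "(g, h)"] that by force+
  have "{p \<in> composable G. \<rho> (fst p) = y \<and> F p \<noteq> 0}
    \<subseteq> (SIGMA g:{g \<in> fst ` C. \<rho> g = y}. {h \<in> snd ` C. \<rho> h = \<sigma> g})" for y
    using mem by (auto simp: composable_def)
  from finite_subset[OF this finite_SigmaI[OF A(1) B(1)]]
  show "finite_fibres (composable_top G) (\<lambda>p. \<rho> (fst p)) F"
    by (simp add: finite_fibres_def)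
  have "{p \<in> composable G. \<sigma> (fst p) = y \<and> F p \<noteq> 0}
    \<subseteq> (SIGMA g:{g \<in> fst ` C. \<sigma> g = y}. {h \<in> snd ` C. \<rho> h = \<sigma> g})" for y
    using mem by (auto simp: composable_def)
  from finite_subset[OF this finite_SigmaI[OF A(2) B(1)]]
  show "finite_fibres (composable_top G) (\<lambda>p. \<sigma> (fst p)) F"
    by (simp add: finite_fibres_def)
  have "{p \<in> composable G. \<sigma> (snd p) = y \<and> F p \<noteq> 0}
    \<subseteq> prod.swap ` (SIGMA h:{h \<in> snd ` C. \<sigma> h = y}. {g \<in> fst ` C. \<sigma> g = \<rho> h})" for y
    using mem by (force simp: composable_def image_iff)
  from finite_subset[OF this finite_imageI[OF finite_SigmaI[OF B(2) A(2)]]]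
  show "finite_fibres (composable_top G) (\<lambda>p. \<sigma> (snd p)) F"
    by (simp add: finite_fibres_def)
qed

abbreviation "prod_map \<equiv> \<lambda>(g, h). g \<odot> h"

lemma composable_prod_map:
  assumes "p \<in> composable G"
  shows "prod_map p \<in> \<Gamma>" "fst p \<in> \<Gamma>" "snd p \<in> \<Gamma>" "\<rho> (prod_map p) = \<rho> (fst p)"
    "\<sigma> (prod_map p) = \<sigma> (snd p)" "\<rho> (snd p) = \<sigma> (fst p)"
  using assms by (auto simp: composable_def)

lemma delta_finite_fibres:
  assumes "F \<in> Cc (composable_top G)"
  shows "finite_fibres (composable_top G) fst F" "finite_fibres (composable_top G) snd F"
    "finite_fibres (composable_top G) prod_map F"
proof -
  note ff = Cc_composable_finite_fibres[OF assms]
  show "finite_fibres (composable_top G) fst F" "finite_fibres (composable_top G) snd F"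
    using ff finite_fibres_coarser by blast+
  have "finite_fibres (composable_top G) (\<lambda>p. \<rho> (prod_map p)) F"
    using ff(1) by (subst finite_fibres_cong[of _ _ "\<lambda>p. \<rho> (fst p)"]) (auto simp: composable_prod_map)
  then show "finite_fibres (composable_top G) prod_map F"
    by (rule finite_fibres_coarser)
qed

lemma delta1_delta2:
  assumes "F \<in> Cc (composable_top G)"
  shows "delta1 G (delta2 G F) x = 0"
proof -
  let ?X = "composable_top G"
  note ff = Cc_composable_finite_fibres[OF assms]
  note cm = composable_prod_map
  have "finite_fibres ?X (\<lambda>p. \<rho> (snd p)) F" "finite_fibres ?X (\<lambda>p. \<rho> (prod_map p)) F"
    "finite_fibres ?X (\<lambda>p. \<sigma> (prod_map p)) F"
    using ff finite_fibres_cong[of ?X "\<lambda>p. \<rho> (snd p)" "\<lambda>p. \<sigma> (fst p)"]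
      finite_fibres_cong[of ?X "\<lambda>p. \<rho> (prod_map p)" "\<lambda>p. \<rho> (fst p)"]
      finite_fibres_cong[of ?X "\<lambda>p. \<sigma> (prod_map p)" "\<lambda>p. \<sigma> (snd p)"]
    by (simp_all only: cm topspace_composable_top)
  note ff = ff this
  \<comment> \<open>These are the simplicial identities: the six composites of \<open>\<rho>\<close>
    and \<open>\<sigma>\<close> with the faces reduce to three, each occurring twice with opposite
    signs.\<close>
  have eq: "push ?X (\<lambda>p. \<rho> (snd p)) = push ?X (\<lambda>p. \<sigma> (fst p))"
    "push ?X (\<lambda>p. \<rho> (prod_map p)) = push ?X (\<lambda>p. \<rho> (fst p))"
    "push ?X (\<lambda>p. \<sigma> (prod_map p)) = push ?X (\<lambda>p. \<sigma> (snd p))"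
    by (intro push_cong; simp only: cm topspace_composable_top)+
  have pc: "push \<T> q (push ?X p F) y = push ?X (\<lambda>x. q (p x)) F y" "finite_fibres \<T> q (push ?X p F)"
    if "finite_fibres ?X (\<lambda>x. q (p x)) F" "p = fst \<or> p = snd \<or> p = prod_map" for p :: "'a \<times> 'a \<Rightarrow> 'a" and q :: "'a \<Rightarrow> 'a" and y
  proof -
    have "p x \<in> topspace \<T>" if "x \<in> topspace ?X" for x
      using \<open>p = fst \<or> p = snd \<or> p = prod_map\<close> that cm(1-3) by (metis topspace_composable_top topspace_eq)
    from push_comp[OF that(1) this]
    show "push \<T> q (push ?X p F) y = push ?X (\<lambda>x. q (p x)) F y" "finite_fibres \<T> q (push ?X p F)"
      by blast+
  qed
  have "push \<T> q (delta2 G F) y = push ?X (\<lambda>p. q (snd p)) F y - push ?X (\<lambda>p. q (prod_map p)) F y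
      + push ?X (\<lambda>p. q (fst p)) F y"
    if "finite_fibres ?X (\<lambda>p. q (fst p)) F" "finite_fibres ?X (\<lambda>p. q (snd p)) F"
      "finite_fibres ?X (\<lambda>p. q (prod_map p)) F" for q :: "'a \<Rightarrow> 'a" and y
    unfolding delta2_def using pc[of q fst] pc[of q snd] pc[of q prod_map] that
    by (simp add: push_add push_diff finite_fibres_diff)
  then show ?thesis
    unfolding delta1_def using ff by (simp add: eq)
qed

text \<open>No cycle condition is imposed, so that indicators of single bisections, which need not
  be cycles, can be compared modulo boundaries.\<close>

definition homologous :: "('a \<Rightarrow> int) \<Rightarrow> ('a \<Rightarrow> int) \<Rightarrow> bool" (infix "\<sim>" 50) where
  "f \<sim> g \<longleftrightarrow> (\<lambda>x. f x - g x) \<in> boundaries1 G"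

lemma boundary_add:
  assumes "a \<in> boundaries1 G" "b \<in> boundaries1 G"
  shows "(\<lambda>x. a x + b x) \<in> boundaries1 G"
proof -
  obtain A B where AB: "A \<in> Cc (composable_top G)" "a = delta2 G A" "B \<in> Cc (composable_top G)" "b = delta2 G B"
    using assms by (auto simp: boundaries1_def)
  have "(\<lambda>x. a x + b x) = delta2 G (\<lambda>p. A p + B p)"
    using AB by (auto simp: delta2_def fun_eq_iff push_add delta_finite_fibres)
  then show ?thesis
    using Cc_combine[OF Hausdorff_composable_top AB(1,3), of "(+)"] by (auto simp: boundaries1_def)
qed

lemma boundary_minus:
  assumes "a \<in> boundaries1 G" shows "(\<lambda>x. - a x) \<in> boundaries1 G"
proof -
  obtain A where A: "A \<in> Cc (composable_top G)" "a = delta2 G A"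
    using assms by (auto simp: boundaries1_def)
  have "(\<lambda>x. - a x) = delta2 G (\<lambda>p. - A p)"
    using A by (auto simp: delta2_def fun_eq_iff push_minus)
  then show ?thesis
    using Cc_combine[OF Hausdorff_composable_top A(1,1), of "\<lambda>a b. - a"] by (auto simp: boundaries1_def)
qed

lemma boundary_zero: "(\<lambda>x. 0) \<in> boundaries1 G"
proof -
  have "(\<lambda>x. 0) = delta2 G (\<lambda>p. 0)"
    by (simp add: delta2_def push_def)
  then show ?thesis
    using Cc_zero[OF Hausdorff_composable_top] by (auto simp: boundaries1_def)
qed

lemma homologous_refl [simp]: "f \<sim> f"
  by (simp add: homologous_def boundary_zero)

lemma homologous_sym: "f \<sim> g \<Longrightarrow> g \<sim> f"
  using boundary_minus by (fastforce simp: homologous_def)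

lemma homologous_trans [trans]: "f \<sim> g \<Longrightarrow> g \<sim> h \<Longrightarrow> f \<sim> h"
  using boundary_add[of "\<lambda>x. f x - g x" "\<lambda>x. g x - h x"] by (simp add: homologous_def)

lemma homologous_add: "f \<sim> g \<Longrightarrow> f' \<sim> g' \<Longrightarrow> (\<lambda>x. f x + f' x) \<sim> (\<lambda>x. g x + g' x)"
  using boundary_add[of "\<lambda>x. f x - g x" "\<lambda>x. f' x - g' x"] by (simp add: homologous_def algebra_simps)

lemma homologous_sum:
  "(\<And>i. i \<in> I \<Longrightarrow> f i \<sim> g i) \<Longrightarrow> (\<lambda>x. \<Sum>i\<in>I. f i x) \<sim> (\<lambda>x. \<Sum>i\<in>I. g i x)"
  by (induction I rule: infinite_finite_induct) (auto intro!: homologous_add)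

lemma hclass_eqI:
  assumes "f \<sim> g" shows "hclass G f = hclass G g"
proof -
  have *: "hclass G f \<subseteq> hclass G g" if "f \<sim> g" for f g
  proof
    fix u assume "u \<in> hclass G f"
    then obtain b where b: "b \<in> boundaries1 G" "u = (\<lambda>x. f x + b x)"
      by (auto simp: hclass_def)
    show "u \<in> hclass G g"
      unfolding hclass_def using boundary_add[OF that[unfolded homologous_def] b(1)] b(2)
      by (intro CollectI exI[of _ "\<lambda>x. (f x - g x) + b x"]) simp
  qed
  show ?thesis
    using *[OF assms] *[OF homologous_sym[OF assms]] by blast
qed

lemma delta1_diff:
  assumes "f \<in> Cc \<T>" "g \<in> Cc \<T>"
  shows "delta1 G (\<lambda>x. f x - g x) x = delta1 G f x - delta1 G g x"
  using assms by (simp add: delta1_def push_diff Cc_finite_fibres)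

lemma delta1_add:
  assumes "f \<in> Cc \<T>" "g \<in> Cc \<T>"
  shows "delta1 G (\<lambda>x. f x + g x) x = delta1 G f x + delta1 G g x"
  using assms by (simp add: delta1_def push_add Cc_finite_fibres)

lemma delta1_zero: "delta1 G (\<lambda>x. 0) x = 0"
  by (simp add: delta1_def push_def)

lemma delta1_sum:
  assumes "\<And>i. i \<in> I \<Longrightarrow> f i \<in> Cc \<T>"
  shows "delta1 G (\<lambda>x. \<Sum>i\<in>I. f i x) x = (\<Sum>i\<in>I. delta1 G (f i) x)"
  using assms
  by (induction I rule: infinite_finite_induct)
    (auto simp: delta1_zero delta1_add Cc_sum Hausdorff)

text \<open>Because boundaries are cycles, the cycle condition can be checked on any homologous
  representative in \<open>Cc \<T>\<close>.\<close>

lemma delta1_homologous: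
  assumes "f \<in> Cc \<T>" "g \<in> Cc \<T>" "f \<sim> g"
  shows "delta1 G f x = delta1 G g x"
proof -
  have "delta1 G (\<lambda>x. f x - g x) x = 0"
    using assms(3) delta1_delta2 by (auto simp: homologous_def boundaries1_def)
  then show ?thesis
    using delta1_diff[OF assms(1,2)] by simp
qed

lemma delta1_indicator:
  "bisection U \<Longrightarrow> delta1 G (indicator U) x = indicator (\<sigma> ` U) x - indicator (\<rho> ` U) x"
  by (simp add: delta1_def push_indicator bisectionD)

lemma Cc_bisection: "bisection U \<Longrightarrow> indicator U \<in> Cc \<T>"
  by (simp add: Cc_indicator Hausdorff bisectionD)

lemma indicator_full_bisection_cycle:
  "U \<in> full_bisections G \<Longrightarrow> indicator U \<in> cycles1 G"
  by (auto simp: cycles1_def full_bisections_iff Cc_bisection delta1_indicator)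

text \<open>Apply \<open>delta2\<close> to the indicator of the set \<open>P\<close> of composable
  pairs in \<open>U \<times> V\<close>. All three faces are injective on \<open>P\<close>, and the
  condition \<open>\<sigma>\<close> on \<open>U\<close> versus \<open>\<rho>\<close> on
  \<open>V\<close> makes the two projections of \<open>P\<close> fill \<open>U\<close> and
  \<open>V\<close>.\<close>

lemma homologous_mult:
  assumes "bisection U" "bisection V" "\<sigma> ` U = \<rho> ` V"
  shows "indicator (U \<cdot> V) \<sim> (\<lambda>x. indicator U x + indicator V x)"
proof -
  note U = bisectionD[OF assms(1)] and V = bisectionD[OF assms(2)]
  define P where "P = composable G \<inter> U \<times> V"
  have PD: "u \<in> U" "v \<in> V" "u \<in> \<Gamma>" "v \<in> \<Gamma>" "\<sigma> u = \<rho> v" if "(u, v) \<in> P" for u v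
    using that U V by (auto simp: P_def composable_def)
  have "openin (composable_top G) P"
    using openin_subtopology_Int[of "prod_topology \<T> \<T>" "U \<times> V" "composable G"] U V
    by (simp add: P_def composable_top_def openin_prod_Times_iff Int_commute)
  then have "compact_open (composable_top G) P"
    using compactin_composable[OF U(5) V(5)] by (simp add: compact_open_def P_def)
  then have "delta2 G (indicator P) \<in> boundaries1 G"
    using Cc_indicator[OF Hausdorff_composable_top] by (auto simp: boundaries1_def)
  also have "delta2 G (indicator P) = (\<lambda>x. indicator V x - indicator (U \<cdot> V) x + indicator U x)"
  proof -
    have sub: "P \<subseteq> composable G" by (simp add: P_def)
    have inj: "inj_on fst P" "inj_on snd P"
    proof -
      have "v = v'" if "(u, v) \<in> P" "(u, v') \<in> P" for u v v'
        using inj_onD[OF V(2), of v v'] PD[OF that(1)] PD[OF that(2)] by simp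
      then show "inj_on fst P"
        by (auto simp: inj_on_def)
      have "u = u'" if "(u, v) \<in> P" "(u', v) \<in> P" for u u' v
        using inj_onD[OF U(3), of u u'] PD[OF that(1)] PD[OF that(2)] by simp
      then show "inj_on snd P"
        by (auto simp: inj_on_def)
    qed
    have inj3: "inj_on prod_map P"
    proof (rule inj_onI)
      fix p q assume "p \<in> P" "q \<in> P" "prod_map p = prod_map q"
      moreover from this have "\<rho> (fst p) = \<rho> (fst q)" "\<sigma> (snd p) = \<sigma> (snd q)"
        using sub by (metis composable_prod_map(4) subsetD, metis composable_prod_map(5) subsetD)
      ultimately show "p = q"
        using U(2) V(3) PD by (metis inj_onD prod.collapse)
    qed
    have P: "(u, v) \<in> P" if "u \<in> U" "v \<in> V" "\<sigma> u = \<rho> v" for u v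
      using that U(1) V(1) by (auto simp: P_def composable_def)
    have fstP: "fst ` P = U"
    proof
      show "U \<subseteq> fst ` P"
      proof
        fix u assume u: "u \<in> U"
        then have "\<sigma> u \<in> \<rho> ` V"
          unfolding assms(3)[symmetric] by simp
        then obtain v where "(u, v) \<in> P"
          using P u by blast
        then show "u \<in> fst ` P"
          by (metis fst_conv imageI)
      qed
    qed (auto simp: P_def)
    have sndP: "snd ` P = V"
    proof
      show "V \<subseteq> snd ` P"
      proof
        fix v assume v: "v \<in> V"
        then have "\<rho> v \<in> \<sigma> ` U"
          unfolding assms(3) by simp
        then obtain u where "u \<in> U" "\<rho> v = \<sigma> u"
          by blast
        then have "(u, v) \<in> P"
          using P v by simp
        then show "v \<in> snd ` P"
          by (metis snd_conv imageI)
      qed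
    qed (auto simp: P_def)
    have "prod_map ` P = U \<cdot> V"
      using U(1) V(1) by (auto simp: P_def set_mult_def composable_def image_iff Bex_def) (blast+)?
    then show ?thesis
      using fstP sndP inj inj3 sub by (simp add: delta2_def push_indicator fun_eq_iff)
  qed
  finally have "(\<lambda>x. indicator V x - indicator (U \<cdot> V) x + indicator U x) \<in> boundaries1 G" .
  then have "(\<lambda>x. indicator U x + indicator V x) \<sim> indicator (U \<cdot> V)"
    by (simp add: homologous_def algebra_simps)
  then show ?thesis
    by (rule homologous_sym)
qed

text \<open>Such a set satisfies \<open>A \<cdot> A = A\<close>, so its indicator is homologous to
  its own double.\<close>

lemma homologous_unit_set:
  assumes "compact_open \<T> A" "A \<subseteq> units G"
  shows "indicator A \<sim> (\<lambda>x. 0)"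
proof -
  have A: "bisection A" "A \<cdot> A = A" "\<sigma> ` A = \<rho> ` A"
  proof -
    have u: "a \<in> \<Gamma>" "\<rho> a = a" "\<sigma> a = a" "a \<odot> a = a" if "a \<in> A" for a
      using subsetD[OF assms(2) that] by (auto, metis mult_simps(1) units_simps(1,2))
    show "bisection A"
      using assms by (rule bisection_units_subset)
    show "A \<cdot> A = A"
      using u unfolding set_mult_def by (auto, metis)
    show "\<sigma> ` A = \<rho> ` A"
      using u by (auto simp: image_iff)
  qed
  have "(\<lambda>x. indicator A x - (indicator A x + indicator A x)) \<in> boundaries1 G"
    using homologous_mult[OF A(1,1,3)] A(2) by (simp add: homologous_def)
  then show ?thesis
    using boundary_minus by (fastforce simp: homologous_def)
qed

text \<open>The product of \<open>U\<close> with its inverse is the range of \<open>U\<close>, a set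
  of units, whose indicator is a boundary.\<close>

lemma homologous_inv:
  assumes "bisection U" shows "indicator (\<iota> ` U) \<sim> (\<lambda>x. - indicator U x)"
proof -
  note U = bisectionD[OF assms]
  have mult: "U \<cdot> \<iota> ` U = \<rho> ` U"
  proof
    show "U \<cdot> \<iota> ` U \<subseteq> \<rho> ` U"
    proof
      fix g assume "g \<in> U \<cdot> \<iota> ` U"
      then obtain u v where uv: "g = u \<odot> \<iota> v" "u \<in> U" "v \<in> U" "\<sigma> u = \<rho> (\<iota> v)"
        unfolding set_mult_def by blast
      then have "u = v"
        using U by (metis inj_onD rng_src(7) subsetD)
      then show "g \<in> \<rho> ` U"
        using uv U(1) by auto
    qed
    show "\<rho> ` U \<subseteq> U \<cdot> \<iota> ` U"
    proof
      fix g assume "g \<in> \<rho> ` U"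
      then obtain u where u: "u \<in> U" "g = \<rho> u" by auto
      then have "g = u \<odot> \<iota> u" "\<sigma> u = \<rho> (\<iota> u)"
        using U(1) by auto
      then show "g \<in> U \<cdot> \<iota> ` U"
        using u unfolding set_mult_def by blast
    qed
  qed
  have "(\<lambda>x. indicator U x + indicator (\<iota> ` U) x) \<sim> indicator (\<rho> ` U)"
    using homologous_mult[OF assms bisection_inv[OF assms]] U(1)
    by (simp add: mult rng_src_inv_image homologous_sym)
  also have "\<dots> \<sim> (\<lambda>x. 0)"
    using U by (intro homologous_unit_set compact_open_rng) auto
  finally show ?thesis
    by (simp add: homologous_def algebra_simps)
qed

section \<open>Compactly supported functions as sums of bisections, up to boundaries\<close>

definition bisection_sum :: "('a \<Rightarrow> int) \<Rightarrow> bool" where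
  "bisection_sum f \<longleftrightarrow> (\<exists>Cs. (\<forall>C\<in>set Cs. bisection C) \<and> f \<sim> (\<lambda>x. \<Sum>C\<leftarrow>Cs. indicator C x))"

lemma bisection_sum_zero: "bisection_sum (\<lambda>x. 0)"
  unfolding bisection_sum_def by (rule exI[of _ "[]"]) simp

lemma bisection_sum_add:
  assumes "bisection_sum f" "bisection_sum g" shows "bisection_sum (\<lambda>x. f x + g x)"
proof -
  obtain Cs Ds where "\<forall>C\<in>set Cs. bisection C" "f \<sim> (\<lambda>x. \<Sum>C\<leftarrow>Cs. indicator C x)"
    "\<forall>C\<in>set Ds. bisection C" "g \<sim> (\<lambda>x. \<Sum>C\<leftarrow>Ds. indicator C x)"
    using assms by (auto simp: bisection_sum_def)
  then show ?thesis
    unfolding bisection_sum_def using homologous_add by (intro exI[of _ "Cs @ Ds"]) auto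
qed

text \<open>Lists permit repetition, which gives positive multiples; negative ones come from the
  inverse bisection. Hence the induction on the integer \<open>c\<close> in both directions.\<close>

lemma bisection_sum_multiple:
  assumes "bisection U" shows "bisection_sum (\<lambda>x. c * indicator U x)"
proof -
  have pos: "bisection_sum (indicator U)"
    unfolding bisection_sum_def using assms by (intro exI[of _ "[U]"]) simp
  have neg: "bisection_sum (\<lambda>x. - indicator U x)"
    unfolding bisection_sum_def using bisection_inv[OF assms] homologous_sym[OF homologous_inv[OF assms]]
    by (intro exI[of _ "[\<iota> ` U]"]) simp
  show ?thesis
  proof (induction c rule: int_induct[of _ 0])
    case base
    show ?case by (simp add: bisection_sum_zero)
  next
    case (step1 i)
    then show ?case
      using bisection_sum_add[OF step1(2) pos] by (simp add: algebra_simps)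
  next
    case (step2 i)
    then show ?case
      using bisection_sum_add[OF step2(2) neg] by (simp add: algebra_simps)
  qed
qed

text \<open>On one bisection after another the nonzero level is split off as a multiple of an
  indicator. Asking for values 0 or \<open>c\<close>, not for constancy, survives this removal:
  afterwards the function is 0 on \<open>U\<close> and unchanged elsewhere, so overlaps in the cover
  do no harm.\<close>

lemma bisection_sum_cover:
  assumes "finite \<U>" "\<And>U. U \<in> \<U> \<Longrightarrow> bisection U \<and> (\<exists>c. \<forall>g\<in>U. f g = 0 \<or> f g = c)"
    and "f \<in> Cc \<T>" "\<And>g. g \<notin> \<Union>\<U> \<Longrightarrow> f g = 0"
  shows "bisection_sum f"
  using assms
proof (induction \<U> arbitrary: f rule: finite_induct)
  case empty
  then have "f = (\<lambda>x. 0)" by auto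
  then show ?case by (simp add: bisection_sum_zero)
next
  case (insert U \<U>)
  obtain c where c: "\<forall>g\<in>U. f g = 0 \<or> f g = c" and U: "bisection U"
    using insert.prems(1) by blast
  define V where "V = {g \<in> U. f g \<noteq> 0}"
  have "compact_open \<T> V"
  proof (rule compact_open_clopen_subset[OF bisectionD(4)[OF U]])
    \<comment> \<open>Local constancy makes every condition on the value of \<open>f\<close> open,
      so \<open>V\<close> and its complement in \<open>U\<close> are both open.\<close>
    have op: "openin \<T> {g \<in> U. P (f g)}" for P
    proof (subst openin_subopen, intro ballI)
      fix g assume g: "g \<in> {g \<in> U. P (f g)}"
      then have "g \<in> topspace \<T>"
        using bisectionD(1)[OF U] by auto
      then obtain W where W: "openin \<T> W" "g \<in> W" "\<forall>h\<in>W. f h = f g"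
        using Cc_locally_constant[OF insert.prems(2)] by blast
      then have "U \<inter> W \<subseteq> {g \<in> U. P (f g)}"
        using g by (metis (mono_tags, lifting) IntE mem_Collect_eq subsetI)
      then show "\<exists>W. openin \<T> W \<and> g \<in> W \<and> W \<subseteq> {g \<in> U. P (f g)}"
        using W(1,2) g bisectionD(6)[OF U] by (intro exI[of _ "U \<inter> W"]) auto
    qed
    show "openin \<T> V" unfolding V_def by (rule op)
    have "closedin \<T> (U - {g \<in> U. f g = 0})"
      using op[of "\<lambda>c. c = 0"] bisectionD(7)[OF U] by (intro closedin_diff)
    then show "closedin \<T> V"
      by (simp add: V_def set_diff_eq cong: conj_cong)
  qed (auto simp: V_def)
  then have V: "bisection V"
    using bisection_subset[OF U] by (auto simp: V_def)
  define f' where "f' = (\<lambda>x. f x - c * indicator V x)"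
  have f': "f' g = (if g \<in> U then 0 else f g)" for g
    using c by (auto simp: f'_def V_def indicator_def)
  have "bisection_sum f'"
  proof (rule insert.IH)
    show "f' \<in> Cc \<T>"
      unfolding f'_def
      by (rule Cc_combine[OF Hausdorff insert.prems(2) Cc_bisection[OF V], of "\<lambda>a b. a - c * b"]) simp
    show "bisection W \<and> (\<exists>c. \<forall>g\<in>W. f' g = 0 \<or> f' g = c)" if "W \<in> \<U>" for W
      using insert.prems(1)[of W] that by (auto simp: f')
    show "f' g = 0" if "g \<notin> \<Union>\<U>" for g
      using insert.prems(3)[of g] that by (auto simp: f')
  qed
  from bisection_sum_add[OF this bisection_sum_multiple[OF V, of c]] show ?case
    by (simp add: f'_def)
qed

text \<open>By local constancy, a compact set carrying \<open>f\<close> is covered by finitely many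
  bisections on each of which \<open>f\<close> is constant.\<close>

lemma Cc_bisection_sum:
  assumes "f \<in> Cc \<T>" shows "bisection_sum f"
proof -
  obtain C where C: "compactin \<T> C" "\<And>x. x \<notin> C \<Longrightarrow> f x = 0"
    using assms CcE by metis
  have "\<exists>W. openin \<T> W \<and> g \<in> W \<and> (\<forall>y\<in>W. f y = f g)" if "g \<in> C" for g
    using that Cc_locally_constant[OF assms, of g] compactin_subset_topspace[OF C(1)] by blast
  then obtain W where W: "\<And>g. g \<in> C \<Longrightarrow> openin \<T> (W g) \<and> g \<in> W g \<and> (\<forall>y\<in>W g. f y = f g)"
    by metis
  obtain \<U> where U: "finite \<U>" "\<And>U. U \<in> \<U> \<Longrightarrow> bisection U \<and> (\<exists>g\<in>C. U \<subseteq> W g)" "C \<subseteq> \<Union>\<U>"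
    using compactin_bisection_cover[OF C(1), of W] W by metis
  show ?thesis
  proof (rule bisection_sum_cover[OF U(1) _ assms])
    show "bisection V \<and> (\<exists>c. \<forall>g\<in>V. f g = 0 \<or> f g = c)" if "V \<in> \<U>" for V
      using U(2)[OF that] W by (metis subsetD)
    show "f g = 0" if "g \<notin> \<Union>\<U>" for g
      using C(2) U(3) that by blast
  qed
qed

end

section \<open>Elementary subgroupoids\<close>

locale elementary = ample_groupoid +
  fixes K :: "'a set"
  assumes elementary: "elementary_subgroupoid G K"
begin

lemma K_subset: "K \<subseteq> \<Gamma>" and K_compact_open: "compact_open \<T> K" and units_subset_K: "units G \<subseteq> K"
  and K_inv: "k \<in> K \<Longrightarrow> \<iota> k \<in> K"
  and K_mult: "k \<in> K \<Longrightarrow> l \<in> K \<Longrightarrow> \<sigma> k = \<rho> l \<Longrightarrow> k \<odot> l \<in> K"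
  and K_principal: "k \<in> K \<Longrightarrow> \<rho> k = \<sigma> k \<Longrightarrow> k \<in> units G"
  using elementary unfolding elementary_subgroupoid_def compact_open_def by blast+

lemma K_carrier [simp]: "k \<in> K \<Longrightarrow> k \<in> \<Gamma>"
  using K_subset by auto

text \<open>For a unit \<open>x\<close> this is the set K(x) whose size is the denominator in almost
  finiteness.\<close>

definition orb :: "'a \<Rightarrow> 'a set" where
  "orb x = \<rho> ` {k \<in> K. \<sigma> k = x}"

lemma orbI: "k \<in> K \<Longrightarrow> \<sigma> k = x \<Longrightarrow> \<rho> k = y \<Longrightarrow> y \<in> orb x"
  by (auto simp: orb_def)

lemma orbE:
  assumes "y \<in> orb x" obtains k where "k \<in> K" "\<sigma> k = x" "\<rho> k = y"
  using assms by (auto simp: orb_def)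

lemma finite_orb [simp]: "finite (orb x)"
  using finite_fibre(2)[of K x] K_compact_open by (simp add: orb_def compact_open_def)

lemma orb_subset: "orb x \<subseteq> units G"
  by (auto elim!: orbE)

lemma orb_self: "x \<in> units G \<Longrightarrow> x \<in> orb x"
  using units_subset_K by (intro orbI[of x]) auto

section \<open>Connectedness, counting and matching in the orbits of \<open>K\<close>\<close>

lemma orb_step:
  assumes "k \<in> K" shows "\<sigma> k \<in> orb x \<longleftrightarrow> \<rho> k \<in> orb x"
proof
  assume "\<sigma> k \<in> orb x"
  then obtain l where "l \<in> K" "\<sigma> l = x" "\<rho> l = \<sigma> k" by (rule orbE)
  then show "\<rho> k \<in> orb x"
    using assms by (intro orbI[of "k \<odot> l"] K_mult) auto
next
  assume "\<rho> k \<in> orb x"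
  then obtain l where "l \<in> K" "\<sigma> l = x" "\<rho> l = \<rho> k" by (rule orbE)
  then show "\<sigma> k \<in> orb x"
    using assms by (intro orbI[of "\<iota> k \<odot> l"] K_mult K_inv) auto
qed

lemma orb_connected:
  assumes "y \<in> orb x" "z \<in> orb x" obtains k where "k \<in> K" "\<sigma> k = y" "\<rho> k = z"
proof -
  obtain l m where l: "l \<in> K" "\<sigma> l = x" "\<rho> l = y" and m: "m \<in> K" "\<sigma> m = x" "\<rho> m = z"
    using assms by (auto elim!: orbE)
  then show thesis
    using that[of "m \<odot> \<iota> l"] K_mult K_inv by auto
qed

text \<open>An arrow of \<open>K\<close> has both ends in one orbit, so the arrows of
  \<open>V\<close> over \<open>orb x\<close> biject its source points there with its range points.
  All later counting rests on this invariance.\<close>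

lemma card_orb_bisection:
  assumes "inj_on \<rho> V" "inj_on \<sigma> V" "V \<subseteq> K"
  shows "card (orb x \<inter> \<sigma> ` V) = card (orb x \<inter> \<rho> ` V)"
proof -
  define V' where "V' = {v \<in> V. \<sigma> v \<in> orb x}"
  have "orb x \<inter> \<sigma> ` V = \<sigma> ` V'" "orb x \<inter> \<rho> ` V = \<rho> ` V'"
    using orb_step assms(3) by (auto simp: V'_def)
  moreover have "inj_on \<rho> V'" "inj_on \<sigma> V'"
    using assms by (auto simp: V'_def intro: inj_on_subset)
  ultimately show ?thesis
    by (simp add: card_image)
qed

text \<open>Maximality of the matching holds because an arrow \<open>t\<close> of \<open>T\<close> with both endpoints still
  unmatched at the end was also available when \<open>T\<close> was processed.\<close>

lemma greedy_matching:
  assumes "\<forall>T\<in>set Ts. bisection T" "compact_open \<T> A" "compact_open \<T> B"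
  shows "\<exists>V. bisection V \<and> V \<subseteq> \<Union>(set Ts) \<and> \<sigma> ` V \<subseteq> A \<and> \<rho> ` V \<subseteq> B \<and>
    (\<forall>T\<in>set Ts. \<forall>t\<in>T. \<not> (\<sigma> t \<in> A - \<sigma> ` V \<and> \<rho> t \<in> B - \<rho> ` V))"
  using assms
proof (induction Ts arbitrary: A B)
  case Nil
  show ?case
    by (intro exI[of _ "{}"]) (simp add: bisection_empty)
next
  case (Cons T Ts)
  \<comment> \<open>These are the arrows of \<open>T\<close> with both ends still available; since
    \<open>T\<close> is a bisection they can all be taken at once.\<close>
  define V where "V = {g \<in> {g \<in> T. \<sigma> g \<in> A}. \<rho> g \<in> B}"
  have V: "bisection V"
  proof (rule bisection_subset[of T])
    show T: "bisection T"
      using Cons.prems(1) by simp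
    show "compact_open \<T> V"
      unfolding V_def
      by (rule compact_open_restrict(1)[OF compact_open_restrict(2)[OF bisectionD(4)[OF T]]]) fact+
  qed (auto simp: V_def)
  have "compact_open \<T> (A - \<sigma> ` V)" "compact_open \<T> (B - \<rho> ` V)"
    using Cons.prems bisectionD(4)[OF V]
    by (auto intro!: compact_open_Diff[OF Hausdorff] compact_open_rng compact_open_src)
  then obtain W where W: "bisection W" "W \<subseteq> \<Union>(set Ts)" "\<sigma> ` W \<subseteq> A - \<sigma> ` V" "\<rho> ` W \<subseteq> B - \<rho> ` V"
    "\<forall>T\<in>set Ts. \<forall>t\<in>T. \<not> (\<sigma> t \<in> A - \<sigma> ` V - \<sigma> ` W \<and> \<rho> t \<in> B - \<rho> ` V - \<rho> ` W)"
    using Cons.IH[of "A - \<sigma> ` V" "B - \<rho> ` V"] Cons.prems(1) by auto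
  show ?case
  proof (intro exI[of _ "V \<union> W"] conjI)
    show "bisection (V \<union> W)"
      using V W by (intro bisection_Un) auto
    show "V \<union> W \<subseteq> \<Union>(set (T # Ts))" "\<sigma> ` (V \<union> W) \<subseteq> A" "\<rho> ` (V \<union> W) \<subseteq> B"
      using W by (auto simp: V_def)
    show "\<forall>T'\<in>set (T # Ts). \<forall>t\<in>T'. \<not> (\<sigma> t \<in> A - \<sigma> ` (V \<union> W) \<and> \<rho> t \<in> B - \<rho> ` (V \<union> W))"
    proof (intro ballI notI)
      fix T' t assume t: "T' \<in> set (T # Ts)" "t \<in> T'" "\<sigma> t \<in> A - \<sigma> ` (V \<union> W) \<and> \<rho> t \<in> B - \<rho> ` (V \<union> W)"
      then have "t \<notin> T"
        by (auto simp: V_def)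
      then show False
        using W(5) t by (auto simp: image_Un)
    qed
  qed
qed

text \<open>A maximal matching already exhausts \<open>A\<close>. Any two points of an orbit are
  joined by an arrow of \<open>K\<close>, so an unmatched \<open>x\<close> in \<open>A\<close>
  forces every point of \<open>orb x \<inter> B\<close> to be matched, and then \<open>A\<close>
  would have more points than \<open>B\<close> in that orbit.\<close>

lemma K_comparison:
  assumes A: "compact_open \<T> A" "A \<subseteq> units G" and B: "compact_open \<T> B"
    and le: "\<And>x. x \<in> units G \<Longrightarrow> card (orb x \<inter> A) \<le> card (orb x \<inter> B)"
  obtains V where "bisection V" "V \<subseteq> K" "\<sigma> ` V = A" "\<rho> ` V \<subseteq> B"
proof -
  have "compactin \<T> K" "openin \<T> K"
    using K_compact_open by (simp_all add: compact_open_def)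
  then obtain \<U> where U: "finite \<U>" "\<And>U. U \<in> \<U> \<Longrightarrow> bisection U \<and> U \<subseteq> K" "K \<subseteq> \<Union>\<U>"
    using compactin_bisection_cover[of K "\<lambda>_. K"] by metis
  obtain Ts where Ts: "set Ts = \<U>"
    using U(1) finite_list by blast
  obtain V where V: "bisection V" "V \<subseteq> \<Union>\<U>" "\<sigma> ` V \<subseteq> A" "\<rho> ` V \<subseteq> B"
    and max: "\<forall>T\<in>\<U>. \<forall>t\<in>T. \<not> (\<sigma> t \<in> A - \<sigma> ` V \<and> \<rho> t \<in> B - \<rho> ` V)"
    using greedy_matching[of Ts A B] U(2) A B unfolding Ts by blast
  have VK: "V \<subseteq> K"
    using V(2) U(2) by blast
  have "A \<subseteq> \<sigma> ` V"
  proof (rule ccontr)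
    assume "\<not> A \<subseteq> \<sigma> ` V"
    then obtain x where x: "x \<in> A" "x \<notin> \<sigma> ` V" by auto
    then have xu: "x \<in> units G" using A(2) by auto
    have "orb x \<inter> B \<subseteq> \<rho> ` V"
    proof
      fix y assume y: "y \<in> orb x \<inter> B"
      then obtain k where "k \<in> K" "\<sigma> k = x" "\<rho> k = y"
        by (auto elim: orbE)
      then show "y \<in> \<rho> ` V"
        using max U(3) x y by blast
    qed
    then have "orb x \<inter> B = orb x \<inter> \<rho> ` V"
      using V(4) by auto
    then have "card (orb x \<inter> B) = card (orb x \<inter> \<sigma> ` V)"
      using card_orb_bisection[of V x] bisectionD(2,3)[OF V(1)] VK by simp
    also have "\<dots> < card (orb x \<inter> A)"
      using x V(3) orb_self[OF xu] by (intro psubset_card_mono) auto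
    finally show False
      using le[OF xu] by simp
  qed
  then show thesis
    using that V VK by blast
qed

lemma card_orb_UN:
  fixes W :: "nat \<Rightarrow> 'a set"
  assumes "\<And>i. i < n \<Longrightarrow> bisection (W i) \<and> W i \<subseteq> K" "disjoint_family_on (\<lambda>i. \<rho> ` W i) {..<n}"
  shows "card (orb x \<inter> (\<Union>i<n. \<rho> ` W i)) = (\<Sum>i<n. card (orb x \<inter> \<sigma> ` W i))"
proof -
  have "orb x \<inter> (\<Union>i<n. \<rho> ` W i) = (\<Union>i<n. orb x \<inter> \<rho> ` W i)"
    by auto
  moreover have "card (\<Union>i<n. orb x \<inter> \<rho> ` W i) = (\<Sum>i<n. card (orb x \<inter> \<rho> ` W i))"
    using assms(2) by (intro card_UN_disjoint) (auto simp: disjoint_family_on_def)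
  moreover have "card (orb x \<inter> \<rho> ` W i) = card (orb x \<inter> \<sigma> ` W i)" if "i < n" for i
    using assms(1)[OF that] card_orb_bisection[of "W i" x] bisectionD(2,3)[of "W i"] by simp
  ultimately show ?thesis
    by simp
qed

lemma card_orb_compl: "card (orb x \<inter> (units G - A)) = card (orb x) - card (orb x \<inter> A)"
proof -
  have "orb x \<inter> (units G - A) = orb x - orb x \<inter> A"
    using orb_subset by auto
  then show ?thesis
    by (simp add: card_Diff_subset)
qed

text \<open>The sets \<open>S i\<close> may overlap. Since the bound counts with multiplicity, the
  part of each orbit left over by the ranges chosen so far still has room for the next set, and
  \<open>K_comparison\<close> moves it there.\<close>

lemma K_packing:
  fixes S :: "nat \<Rightarrow> 'a set"
  assumes "\<And>i. i < n \<Longrightarrow> compact_open \<T> (S i) \<and> S i \<subseteq> units G"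
    and "\<And>x. x \<in> units G \<Longrightarrow> (\<Sum>i<n. card (orb x \<inter> S i)) \<le> card (orb x)"
  shows "\<exists>W. (\<forall>i<n. bisection (W i) \<and> W i \<subseteq> K \<and> \<sigma> ` W i = S i) \<and>
    disjoint_family_on (\<lambda>i. \<rho> ` W i) {..<n}"
  using assms
proof (induction n)
  case 0
  show ?case by (simp add: disjoint_family_on_def)
next
  case (Suc n)
  have "(\<Sum>i<n. card (orb x \<inter> S i)) \<le> card (orb x)" if "x \<in> units G" for x
    using Suc.prems(2)[OF that] by simp
  then obtain W where W: "\<forall>i<n. bisection (W i) \<and> W i \<subseteq> K \<and> \<sigma> ` W i = S i"
    "disjoint_family_on (\<lambda>i. \<rho> ` W i) {..<n}"
    using Suc by (metis less_Suc_eq)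
  define R where "R = (\<Union>i<n. \<rho> ` W i)"
  have R: "compact_open \<T> (units G - R)"
    unfolding R_def using W(1)
    by (intro compact_open_Diff[OF Hausdorff compact_open_units] compact_open_UN compact_open_rng)
      (auto simp: bisectionD)
  have "card (orb x \<inter> S n) \<le> card (orb x \<inter> (units G - R))" if x: "x \<in> units G" for x
  proof -
    have "card (orb x \<inter> R) = (\<Sum>i<n. card (orb x \<inter> S i))"
      unfolding R_def using W card_orb_UN[of n W x] by simp
    then show ?thesis
      using Suc.prems(2)[OF x] by (simp add: card_orb_compl)
  qed
  then obtain V where V: "bisection V" "V \<subseteq> K" "\<sigma> ` V = S n" "\<rho> ` V \<subseteq> units G - R"
    using K_comparison[of "S n" "units G - R"] Suc.prems(1)[of n] R by auto
  have d: "\<rho> ` V \<inter> \<rho> ` W i = {}" if "i < n" for i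
    using V(4) that unfolding R_def by blast
  have "disjoint_family_on (\<lambda>i. \<rho> ` (W(n := V)) i) {..<Suc n}"
    unfolding disjoint_family_on_def
  proof (intro ballI impI)
    fix i j assume "i \<in> {..<Suc n}" "j \<in> {..<Suc n}" "i \<noteq> j"
    then show "\<rho> ` (W(n := V)) i \<inter> \<rho> ` (W(n := V)) j = {}"
      using W(2) d[of i] d[of j] by (cases "i = n"; cases "j = n") (auto simp: disjoint_family_on_def)
  qed
  then show ?case
    using W(1) V by (intro exI[of _ "W(n := V)"]) (auto simp: less_Suc_eq)
qed

text \<open>Distinct points of one orbit are joined by a non-unit arrow of \<open>K\<close>, so
  these are the partial transversals: compact open sets of units meeting each orbit at most
  once.\<close>

definition independent :: "'a set \<Rightarrow> bool" where
  "independent Y \<longleftrightarrow> compact_open \<T> Y \<and> Y \<subseteq> units G \<and> (\<forall>k\<in>K. \<sigma> k \<in> Y \<longrightarrow> \<rho> k \<in> Y \<longrightarrow> k \<in> units G)"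

text \<open>The pairs of ends of non-unit arrows of \<open>K\<close> form a compact, hence closed,
  set, and principality keeps it off the diagonal. A product neighbourhood of \<open>(x, x)\<close>
  missing this set yields \<open>Y\<close>.\<close>

lemma independent_nbhd:
  assumes "x \<in> units G" obtains Y where "independent Y" "x \<in> Y"
proof -
  define N where "N = (\<lambda>g. (\<rho> g, \<sigma> g)) ` (K - units G)"
  have "compactin \<T> (K - units G)"
    using compact_open_Diff[OF Hausdorff K_compact_open compact_open_units] by (simp add: compact_open_def)
  then have "compactin (prod_topology \<T> \<T>) N"
    unfolding N_def
    by (rule image_compactin) (simp add: continuous_map_pairedI continuous_rng continuous_src)
  then have "closedin (prod_topology \<T> \<T>) N"
    by (simp add: compactin_imp_closedin Hausdorff Hausdorff_space_prod_topology)
  then have op: "openin (prod_topology \<T> \<T>) (\<Gamma> \<times> \<Gamma> - N)"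
    by (metis openin_closedin_eq openin_diff openin_topspace topspace_eq topspace_prod_topology)
  have "(x, x) \<in> \<Gamma> \<times> \<Gamma> - N"
    using assms K_principal by (auto simp: N_def)
  then obtain A B where AB: "openin \<T> A" "openin \<T> B" "x \<in> A" "x \<in> B" "A \<times> B \<subseteq> \<Gamma> \<times> \<Gamma> - N"
    using op[unfolded openin_prod_topology_alt, rule_format, of x x] by blast
  then obtain Y where Y: "bisection Y" "x \<in> Y" "Y \<subseteq> A \<inter> B \<inter> units G"
    using bisection_nbhd_base[of "A \<inter> B \<inter> units G" x] openin_units assms by blast
  have "k \<in> units G" if "k \<in> K" "\<sigma> k \<in> Y" "\<rho> k \<in> Y" for k
  proof (rule ccontr)
    assume "k \<notin> units G"
    then have "(\<rho> k, \<sigma> k) \<in> N"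
      using that by (auto simp: N_def)
    moreover have "(\<rho> k, \<sigma> k) \<in> A \<times> B"
      using that Y(3) by auto
    ultimately show False
      using AB(5) by blast
  qed
  then have "independent Y"
    unfolding independent_def using Y(3) bisectionD(4)[OF Y(1)] by blast
  then show thesis
    using that Y(2) by blast
qed

text \<open>A new set \<open>Z\<close> is reduced by the \<open>K\<close>-saturation
  \<open>S\<close> of the old \<open>Y\<close> before it is added. Points of \<open>Z\<close> in
  \<open>S\<close> already have a representative, and as \<open>S\<close> is invariant no arrow of
  \<open>K\<close> joins the other points to \<open>Y\<close>.\<close>

lemma independent_extend:
  assumes "finite \<Y>" "\<And>Y. Y \<in> \<Y> \<Longrightarrow> independent Y"
  shows "\<exists>Y. independent Y \<and> (\<forall>x\<in>\<Union>\<Y>. orb x \<inter> Y \<noteq> {})"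
  using assms
proof (induction \<Y> rule: finite_induct)
  case empty
  show ?case
    by (intro exI[of _ "{}"]) (auto simp: independent_def compact_open_empty)
next
  case (insert Z \<Y>)
  then obtain Y where Y: "independent Y" "\<forall>x\<in>\<Union>\<Y>. orb x \<inter> Y \<noteq> {}" and Z: "independent Z"
    by auto
  define S where "S = \<rho> ` {k \<in> K. \<sigma> k \<in> Y}"
  have S: "compact_open \<T> S"
    unfolding S_def using Y(1)
    by (intro compact_open_rng compact_open_restrict K_compact_open) (simp add: independent_def)
  have S_iff: "x \<in> S \<longleftrightarrow> orb x \<inter> Y \<noteq> {}" for x
  proof
    assume "x \<in> S"
    then obtain k where k: "k \<in> K" "\<sigma> k \<in> Y" "\<rho> k = x" by (auto simp: S_def)
    then have "\<sigma> k \<in> orb x"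
      using K_inv by (intro orbI[of "\<iota> k"]) auto
    then show "orb x \<inter> Y \<noteq> {}"
      using k by auto
  next
    assume "orb x \<inter> Y \<noteq> {}"
    then obtain k where k: "k \<in> K" "\<sigma> k = x" "\<rho> k \<in> Y" by (auto elim: orbE)
    then have "\<iota> k \<in> {k \<in> K. \<sigma> k \<in> Y}" "x = \<rho> (\<iota> k)"
      using K_inv by auto
    then show "x \<in> S"
      unfolding S_def by blast
  qed
  have YS: "Y \<subseteq> S"
    using orb_self Y(1) unfolding independent_def by (blast intro: S_iff[THEN iffD2])
  have step: "\<sigma> k \<in> S \<longleftrightarrow> \<rho> k \<in> S" if "k \<in> K" for k
  proof -
    have "orb (\<sigma> k) = orb (\<rho> k)"
    proof (intro equalityI subsetI)
      fix y assume "y \<in> orb (\<sigma> k)"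
      moreover have "\<rho> k \<in> orb (\<sigma> k)" using that by (intro orbI) auto
      ultimately obtain l where "l \<in> K" "\<sigma> l = \<rho> k" "\<rho> l = y" by (metis orb_connected)
      then show "y \<in> orb (\<rho> k)" by (intro orbI)
    next
      fix y assume "y \<in> orb (\<rho> k)"
      moreover have "\<sigma> k \<in> orb (\<rho> k)" using that K_inv by (intro orbI[of "\<iota> k"]) auto
      ultimately obtain l where "l \<in> K" "\<sigma> l = \<sigma> k" "\<rho> l = y" by (metis orb_connected)
      then show "y \<in> orb (\<sigma> k)" by (intro orbI)
    qed
    then show ?thesis
      by (simp add: S_iff)
  qed
  show ?case
  proof (intro exI[of _ "Y \<union> (Z - S)"] conjI ballI)
    show "independent (Y \<union> (Z - S))"
      unfolding independent_def
    proof (intro conjI ballI impI)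
      show "compact_open \<T> (Y \<union> (Z - S))" "Y \<union> (Z - S) \<subseteq> units G"
        using Y(1) Z S by (auto simp: independent_def intro!: compact_open_Un compact_open_Diff[OF Hausdorff])
      show "k \<in> units G" if "k \<in> K" "\<sigma> k \<in> Y \<union> (Z - S)" "\<rho> k \<in> Y \<union> (Z - S)" for k
        using that step[OF that(1)] YS Y(1) Z unfolding independent_def by blast
    qed
    fix x assume x: "x \<in> \<Union>(insert Z \<Y>)"
    show "orb x \<inter> (Y \<union> (Z - S)) \<noteq> {}"
    proof (cases "x \<in> Z")
      case True
      then have "x \<in> orb x"
        using Z orb_self by (auto simp: independent_def)
      then show ?thesis
        using True S_iff[of x] by blast
    qed (use x Y(2) in blast)
  qed
qed

text \<open>The set \<open>\<Theta>\<close> is a continuous choice, for each unit, of an arrow of \<open>K\<close> to a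
  fixed representative of its orbit.\<close>

lemma K_transversal:
  obtains \<Theta> where "compact_open \<T> \<Theta>" "\<Theta> \<subseteq> K" "inj_on \<sigma> \<Theta>" "\<sigma> ` \<Theta> = units G"
    "\<And>\<theta> k. \<theta> \<in> \<Theta> \<Longrightarrow> k \<in> K \<Longrightarrow> \<sigma> \<theta> = \<rho> k \<Longrightarrow> \<theta> \<odot> k \<in> \<Theta>"
proof -
  have "units G \<subseteq> \<Union>{Y. independent Y}"
    using independent_nbhd by blast
  then obtain \<Y> where "finite \<Y>" "\<Y> \<subseteq> {Y. independent Y}" "units G \<subseteq> \<Union>\<Y>"
    using compactinD[of \<T> "units G" "{Y. independent Y}"] compact_open_units
    by (auto simp: compact_open_def independent_def)
  then obtain Y where Y: "independent Y" "\<And>x. x \<in> units G \<Longrightarrow> orb x \<inter> Y \<noteq> {}"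
    using independent_extend[of \<Y>] by blast
  define \<Theta> where "\<Theta> = {k \<in> K. \<rho> k \<in> Y}"
  show thesis
  proof
    show "compact_open \<T> \<Theta>"
      unfolding \<Theta>_def using Y(1) K_compact_open by (intro compact_open_restrict) (auto simp: independent_def)
    show "\<Theta> \<subseteq> K" by (auto simp: \<Theta>_def)
    show "inj_on \<sigma> \<Theta>"
    proof (rule inj_onI)
      fix k l assume "k \<in> \<Theta>" "l \<in> \<Theta>" "\<sigma> k = \<sigma> l"
      then have kl: "k \<in> K" "l \<in> K" "\<rho> k \<in> Y" "\<rho> l \<in> Y" "\<sigma> k = \<sigma> l" by (auto simp: \<Theta>_def)
      \<comment> \<open>This arrow joins two points of the transversal, so independence makes it a
        unit.\<close>
      then have "k \<odot> \<iota> l \<in> K" "\<sigma> (k \<odot> \<iota> l) = \<rho> l" "\<rho> (k \<odot> \<iota> l) = \<rho> k"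
        using K_mult K_inv by auto
      then have "k \<odot> \<iota> l \<in> units G"
        using Y(1) kl(3,4) unfolding independent_def by metis
      then show "k = l"
        using kl eq_if_mult_inv_unit by (metis K_carrier)
    qed
    show "\<sigma> ` \<Theta> = units G"
    proof
      show "\<sigma> ` \<Theta> \<subseteq> units G" by (auto simp: \<Theta>_def)
      show "units G \<subseteq> \<sigma> ` \<Theta>"
      proof
        fix x assume "x \<in> units G"
        then obtain k where "k \<in> K" "\<sigma> k = x" "\<rho> k \<in> Y"
          using Y(2)[of x] by (auto elim: orbE)
        then show "x \<in> \<sigma> ` \<Theta>" by (auto simp: \<Theta>_def)
      qed
    qed
    show "\<theta> \<odot> k \<in> \<Theta>" if "\<theta> \<in> \<Theta>" "k \<in> K" "\<sigma> \<theta> = \<rho> k" for \<theta> k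
      using that K_mult by (auto simp: \<Theta>_def)
  qed
qed

text \<open>Coning off along \<open>\<Theta>\<close> is a contracting homotopy: writing \<open>\<theta> x\<close> for the arrow of \<open>\<Theta>\<close>
  with source \<open>x\<close>, the boundary of \<open>(\<theta> (r k), k)\<close> is \<open>k - \<theta> (s k) + \<theta> (r k)\<close>.\<close>

lemma K_cycle_boundary:
  assumes f: "f \<in> Cc \<T>" "\<And>g. g \<notin> K \<Longrightarrow> f g = 0" "\<And>x. x \<in> units G \<Longrightarrow> delta1 G f x = 0"
  shows "f \<in> boundaries1 G"
proof -
  obtain \<Theta> where \<Theta>: "compact_open \<T> \<Theta>" "\<Theta> \<subseteq> K" "inj_on \<sigma> \<Theta>" "\<sigma> ` \<Theta> = units G"
    and absorb: "\<And>\<theta> k. \<theta> \<in> \<Theta> \<Longrightarrow> k \<in> K \<Longrightarrow> \<sigma> \<theta> = \<rho> k \<Longrightarrow> \<theta> \<odot> k \<in> \<Theta>"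
    using K_transversal by metis
  let ?X = "composable_top G"
  define F where "F = (\<lambda>p. if p \<in> composable G \<and> fst p \<in> \<Theta> then f (snd p) else 0)"
  obtain C where C: "compactin \<T> C" "\<And>x. x \<notin> C \<Longrightarrow> f x = 0"
    using f(1) CcE by metis
  have F: "F \<in> Cc ?X"
  proof (rule CcI[OF Hausdorff_composable_top])
    show "compactin ?X (composable G \<inter> \<Theta> \<times> C)"
      using \<Theta>(1) C(1) by (intro compactin_composable) (auto simp: compact_open_def)
    show "F p = 0" if "p \<notin> composable G \<inter> \<Theta> \<times> C" for p
      using that C(2) by (cases p) (auto simp: F_def)
    fix p assume "p \<in> topspace ?X"
    then have p: "p \<in> composable G" "fst p \<in> \<Gamma>" "snd p \<in> topspace \<T>"
      by (auto simp: composable_def)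
    obtain V where V: "openin \<T> V" "snd p \<in> V" "\<forall>y\<in>V. f y = f (snd p)"
      using Cc_locally_constant[OF f(1) p(3)] by blast
    \<comment> \<open>\<open>\<Theta>\<close> is clopen, so membership of the first entry in
      \<open>\<Theta>\<close> is locally constant.\<close>
    define O' where "O' = (if fst p \<in> \<Theta> then \<Theta> else \<Gamma> - \<Theta>)"
    have "openin \<T> O'"
      using \<Theta>(1) compact_open_imp_closed[OF Hausdorff \<Theta>(1)]
      by (auto simp: O'_def compact_open_def closedin_def)
    then have "openin ?X (composable G \<inter> O' \<times> V)"
      using openin_subtopology_Int[of "prod_topology \<T> \<T>" "O' \<times> V" "composable G"] V(1)
      by (simp add: composable_top_def openin_prod_Times_iff Int_commute)
    moreover have "p \<in> composable G \<inter> O' \<times> V"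
      using p V(2) by (cases p) (auto simp: O'_def)
    moreover have "F q = F p" if "q \<in> composable G \<inter> O' \<times> V" for q
    proof -
      have "fst q \<in> \<Theta> \<longleftrightarrow> fst p \<in> \<Theta>" "snd q \<in> V" "q \<in> composable G"
        using that by (auto simp: O'_def split: if_splits)
      then show ?thesis
        using V(3) p(1) by (simp add: F_def)
    qed
    ultimately show "\<exists>V. openin ?X V \<and> p \<in> V \<and> (\<forall>q\<in>V. F q = F p)"
      by blast
  qed
  have Fpair: "F (g, h) = (if g \<in> \<Theta> \<and> h \<in> \<Gamma> \<and> \<sigma> g = \<rho> h then f h else 0)" for g h
    using \<Theta>(2) by (auto simp: F_def composable_def)
  have fK: "h \<in> K" if "f h \<noteq> 0" for h
    using f(2) that by blast
  have \<Theta>\<Gamma>: "\<theta> \<in> \<Gamma>" "\<theta> \<in> K" if "\<theta> \<in> \<Theta>" for \<theta>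
    using that \<Theta>(2) by auto
  have "push ?X snd F g = f g" for g
  proof (cases "f g = 0")
    case True
    then have "push ?X snd F g = sum F {}"
      by (intro push_eq_sum) (auto simp: Fpair split: if_splits)
    then show ?thesis
      using True by simp
  next
    case False
    then have g: "g \<in> \<Gamma>" using fK by auto
    then have "\<rho> g \<in> \<sigma> ` \<Theta>"
      unfolding \<Theta>(4) by simp
    then obtain \<theta> where \<theta>: "\<theta> \<in> \<Theta>" "\<rho> g = \<sigma> \<theta>" by blast
    have "push ?X snd F g = sum F {(\<theta>, g)}"
    proof (rule push_eq_sum)
      show "{(\<theta>, g)} \<subseteq> {x \<in> topspace ?X. snd x = g}"
        using g \<theta> \<Theta>\<Gamma>[OF \<theta>(1)] by (simp add: composable_def)
      fix p assume p: "p \<in> topspace ?X" "snd p = g" "F p \<noteq> 0"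
      then have "fst p \<in> \<Theta>" "\<sigma> (fst p) = \<rho> g"
        by (cases p; auto simp: Fpair split: if_splits)+
      then have "fst p = \<theta>"
        using inj_onD[OF \<Theta>(3), of "fst p" \<theta>] \<theta> by simp
      then show "p \<in> {(\<theta>, g)}"
        using p(2) by (cases p) simp
    qed simp
    then show ?thesis
      using \<theta> g by (simp add: Fpair)
  qed
  \<comment> \<open>For \<open>g\<close> in \<open>\<Theta>\<close> the pairs with first entry
    \<open>g\<close> are indexed by the arrows \<open>h\<close> with range
    \<open>\<sigma> g\<close>, so their sum is the push-forward of \<open>f\<close> along
    \<open>\<rho>\<close> at that unit.\<close>
  moreover have "push ?X fst F g = (if g \<in> \<Theta> then push \<T> \<rho> f (\<sigma> g) else 0)" for g
  proof (cases "g \<in> \<Theta>")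
    case True
    define B where "B = {h \<in> topspace \<T>. \<rho> h = \<sigma> g \<and> f h \<noteq> 0}"
    have "finite B"
      using Cc_finite_fibres(1)[OF f(1)] by (simp add: B_def finite_fibres_def)
    then have "push ?X fst F g = sum F ((\<lambda>h. (g, h)) ` B)"
      using True \<Theta>\<Gamma>
      by (intro push_eq_sum) (auto simp: Fpair B_def composable_def split: if_splits)
    also have "\<dots> = (\<Sum>h\<in>B. F (g, h))"
      by (subst sum.reindex) (auto simp: inj_on_def)
    also have "\<dots> = (\<Sum>h\<in>B. f h)"
      using True by (intro sum.cong) (auto simp: Fpair B_def)
    finally show ?thesis
      using True by (simp add: push_def B_def)
  next
    case False
    then have "push ?X fst F g = sum F {}"
      by (intro push_eq_sum) (auto simp: Fpair split: if_splits)
    then show ?thesis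
      using False by simp
  qed
  \<comment> \<open>A pair \<open>(a, h)\<close> with product \<open>g\<close> has
    \<open>a = g \<odot> \<iota> h\<close>. For \<open>h\<close> in \<open>K\<close>, absorption
    puts \<open>a\<close> into \<open>\<Theta>\<close> exactly when \<open>g\<close> lies there, so
    the sum over \<open>h\<close> is the push-forward along \<open>\<sigma>\<close>.\<close>
  moreover have "push ?X prod_map F g = (if g \<in> \<Theta> then push \<T> \<sigma> f (\<sigma> g) else 0)" for g
  proof (cases "g \<in> \<Theta>")
    case True
    define B where "B = {h \<in> topspace \<T>. \<sigma> h = \<sigma> g \<and> f h \<noteq> 0}"
    have g: "g \<in> \<Gamma>" "g \<in> K" using True \<Theta>\<Gamma> by auto
    have B: "h \<in> \<Gamma>" "h \<in> K" "\<sigma> h = \<sigma> g" "g \<odot> \<iota> h \<in> \<Theta>" if "h \<in> B" for h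
      using that fK g True absorb[OF True K_inv[of h]] by (auto simp: B_def)
    have "finite B"
      using Cc_finite_fibres(2)[OF f(1)] by (simp add: B_def finite_fibres_def)
    then have "push ?X prod_map F g = sum F ((\<lambda>h. (g \<odot> \<iota> h, h)) ` B)"
    proof (intro push_eq_sum)
      show "(\<lambda>h. (g \<odot> \<iota> h, h)) ` B \<subseteq> {x \<in> topspace ?X. prod_map x = g}"
        using B g by (auto simp: composable_def)
      fix p assume p: "p \<in> topspace ?X" "prod_map p = g" "F p \<noteq> 0"
      obtain a h where "p = (a, h)" by force
      then have a: "a \<in> \<Gamma>" "h \<in> \<Gamma>" "\<sigma> a = \<rho> h" "a \<odot> h = g" "f h \<noteq> 0"
        using p by (auto simp: Fpair composable_def split: if_splits)
      then have "a = g \<odot> \<iota> h" "h \<in> B"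
        by (auto simp: B_def)
      then show "p \<in> (\<lambda>h. (g \<odot> \<iota> h, h)) ` B"
        using \<open>p = (a, h)\<close> by simp
    qed simp
    also have "\<dots> = (\<Sum>h\<in>B. F (g \<odot> \<iota> h, h))"
      by (subst sum.reindex) (auto simp: inj_on_def)
    also have "\<dots> = (\<Sum>h\<in>B. f h)"
      using B g by (intro sum.cong) (auto simp: Fpair)
    finally show ?thesis
      using True by (simp add: push_def B_def)
  next
    case False
    have "push ?X prod_map F g = sum F {}"
    proof (intro push_eq_sum)
      fix p assume p: "p \<in> topspace ?X" "prod_map p = g" "F p \<noteq> 0"
      obtain a h where "p = (a, h)" by force
      then have "a \<in> \<Theta>" "h \<in> K" "\<sigma> a = \<rho> h" "a \<odot> h = g"
        using p fK by (auto simp: Fpair split: if_splits)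
      then show "p \<in> {}"
        using absorb False by blast
    qed auto
    then show ?thesis
      using False by simp
  qed
  \<comment> \<open>The two push-forwards combine to \<open>delta1 G f\<close> at the source of
    \<open>g\<close>, a unit, where the cycle condition makes it 0.\<close>
  ultimately have "delta2 G F g = f g - (if g \<in> \<Theta> then delta1 G f (\<sigma> g) else 0)" for g
    by (simp add: delta2_def delta1_def)
  then have "delta2 G F = f"
    using f(3) \<Theta>\<Gamma> by (auto simp: fun_eq_iff)
  then show ?thesis
    using F by (auto simp: boundaries1_def)
qed

end

section \<open>Realising cycles by full bisections\<close>

context ample_groupoid
begin

lemma bisection_UN:
  fixes U :: "nat \<Rightarrow> 'a set"
  assumes "\<And>i. i < n \<Longrightarrow> bisection (U i)"
    and "disjoint_family_on (\<lambda>i. \<rho> ` U i) {..<n}" "disjoint_family_on (\<lambda>i. \<sigma> ` U i) {..<n}"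
  shows "bisection (\<Union>i<n. U i)"
  using assms
proof (induction n)
  case 0
  show ?case by (simp add: bisection_empty)
next
  case (Suc n)
  have "disjoint_family_on (\<lambda>i. \<rho> ` U i) {..<n}" "disjoint_family_on (\<lambda>i. \<sigma> ` U i) {..<n}"
    using Suc.prems(2,3) by (simp_all add: disjoint_family_on_def)
  then have "bisection (\<Union>i<n. U i)"
    using Suc by simp
  moreover have "p ` U n \<inter> p ` (\<Union>i<n. U i) = {}" if "disjoint_family_on (\<lambda>i. p ` U i) {..<Suc n}"
    for p :: "'a \<Rightarrow> 'a"
  proof -
    have "p ` U n \<inter> p ` U i = {}" if "i < n" for i
      using disjoint_family_onD[OF \<open>disjoint_family_on (\<lambda>i. p ` U i) {..<Suc n}\<close>, of n i] that by simp
    then show ?thesis by blast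
  qed
  ultimately have "bisection (U n \<union> (\<Union>i<n. U i))"
    using Suc.prems by (intro bisection_Un) auto
  then show ?case
    by (simp add: lessThan_Suc)
qed

end

context elementary
begin

text \<open>Summed over an orbit, the cycle condition equates the source and range counts of the
  whole \<open>C i\<close>. The pieces \<open>C i \<inter> K\<close> are balanced one by one by
  \<open>card_orb_bisection\<close> and can be subtracted.\<close>

lemma balanced_outside_K:
  fixes C :: "nat \<Rightarrow> 'a set"
  assumes C: "\<And>i. i < n \<Longrightarrow> bisection (C i)"
    and cyc: "\<And>x. x \<in> units G \<Longrightarrow> (\<Sum>i<n. indicator (\<sigma> ` C i) x) = (\<Sum>i<n. indicator (\<rho> ` C i) x :: int)"
  shows "(\<Sum>i<n. card (orb x \<inter> \<sigma> ` (C i - K))) = (\<Sum>i<n. card (orb x \<inter> \<rho> ` (C i - K)))"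
proof -
  have split: "card (orb x \<inter> p ` C i) = card (orb x \<inter> p ` (C i - K)) + card (orb x \<inter> p ` (C i \<inter> K))"
    if "inj_on p (C i)" for p i
    using card_Int_image_Un[of "orb x" p "C i - K" "C i \<inter> K"] that by (simp add: Un_Diff_Int) blast
  have total: "(\<Sum>i<n. int (card (orb x \<inter> p ` C i))) = (\<Sum>y\<in>orb x. \<Sum>i<n. indicator (p ` C i) y)" for p
    by (simp add: card_Int_eq_sum_indicator) (rule sum.swap)
  have "(\<Sum>i<n. int (card (orb x \<inter> \<sigma> ` C i))) = (\<Sum>i<n. int (card (orb x \<inter> \<rho> ` C i)))"
    unfolding total by (rule sum.cong[OF refl cyc]) (rule subsetD[OF orb_subset])
  then have "(\<Sum>i<n. card (orb x \<inter> \<sigma> ` C i)) = (\<Sum>i<n. card (orb x \<inter> \<rho> ` C i))"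
    by (simp flip: of_nat_sum)
  moreover have "(\<Sum>i<n. card (orb x \<inter> \<sigma> ` C i))
      = (\<Sum>i<n. card (orb x \<inter> \<sigma> ` (C i - K))) + (\<Sum>i<n. card (orb x \<inter> \<sigma> ` (C i \<inter> K)))"
    using C bisectionD(3) by (simp add: split sum.distrib)
  moreover have "(\<Sum>i<n. card (orb x \<inter> \<rho> ` C i))
      = (\<Sum>i<n. card (orb x \<inter> \<rho> ` (C i - K))) + (\<Sum>i<n. card (orb x \<inter> \<rho> ` (C i \<inter> K)))"
    using C bisectionD(2) by (simp add: split sum.distrib)
  moreover have "(\<Sum>i<n. card (orb x \<inter> \<sigma> ` (C i \<inter> K))) = (\<Sum>i<n. card (orb x \<inter> \<rho> ` (C i \<inter> K)))"
  proof (rule sum.cong[OF refl])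
    fix i assume "i \<in> {..<n}"
    then show "card (orb x \<inter> \<sigma> ` (C i \<inter> K)) = card (orb x \<inter> \<rho> ` (C i \<inter> K))"
      using bisectionD(2,3)[OF C[of i]]
      by (intro card_orb_bisection) (auto intro: inj_on_subset)
  qed
  ultimately show ?thesis
    by simp
qed

text \<open>The full bisection is assembled from the parts \<open>E i\<close> and arrows of
  \<open>K\<close>. The pieces \<open>C i \<inter> K\<close> are accounted for only at the end,
  within a difference that is a cycle supported on \<open>K\<close>.\<close>

lemma full_bisection_of_small_sum:
  fixes C :: "nat \<Rightarrow> 'a set"
  assumes C: "\<And>i. i < n \<Longrightarrow> bisection (C i)"
    and cyc: "\<And>x. x \<in> units G \<Longrightarrow> (\<Sum>i<n. indicator (\<sigma> ` C i) x) = (\<Sum>i<n. indicator (\<rho> ` C i) x :: int)"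
    and small: "\<And>x. x \<in> units G \<Longrightarrow> (\<Sum>i<n. card (orb x \<inter> \<sigma> ` (C i - K))) \<le> card (orb x)"
  obtains U where "U \<in> full_bisections G" "indicator U \<sim> (\<lambda>x. \<Sum>i<n. indicator (C i) x)"
proof -
  define E where "E i = C i - K" for i
  have E: "bisection (E i)" if "i < n" for i
    unfolding E_def
    by (rule bisection_subset[OF C[OF that]
          compact_open_Diff[OF Hausdorff bisectionD(4)[OF C[OF that]] K_compact_open]]) auto
  have ED: "E i \<subseteq> \<Gamma>" "compact_open \<T> (\<sigma> ` E i)" "compact_open \<T> (\<rho> ` E i)" if "i < n" for i
    using bisectionD(1,4)[OF E[OF that]] by (auto intro: compact_open_src compact_open_rng)
  have small': "(\<Sum>i<n. card (orb x \<inter> \<sigma> ` E i)) \<le> card (orb x)"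
    "(\<Sum>i<n. card (orb x \<inter> \<rho> ` E i)) \<le> card (orb x)" if "x \<in> units G" for x
    using small[OF that] balanced_outside_K[of n C x, OF C cyc] by (simp_all add: E_def)
  have unitsE: "\<sigma> ` E i \<subseteq> units G" "\<rho> ` E i \<subseteq> units G" if "i < n" for i
    using ED(1)[OF that] by auto
  obtain W where W: "\<And>i. i < n \<Longrightarrow> bisection (W i)" "\<And>i. i < n \<Longrightarrow> W i \<subseteq> K"
    "\<And>i. i < n \<Longrightarrow> \<sigma> ` W i = \<sigma> ` E i" and Wd: "disjoint_family_on (\<lambda>i. \<rho> ` W i) {..<n}"
    using K_packing[of n "\<lambda>i. \<sigma> ` E i"] ED(2) unitsE(1) small'(1) by metis
  obtain V where V: "\<And>i. i < n \<Longrightarrow> bisection (V i)" "\<And>i. i < n \<Longrightarrow> V i \<subseteq> K"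
    "\<And>i. i < n \<Longrightarrow> \<sigma> ` V i = \<rho> ` E i" and Vd: "disjoint_family_on (\<lambda>i. \<rho> ` V i) {..<n}"
    using K_packing[of n "\<lambda>i. \<rho> ` E i"] ED(3) unitsE(2) small'(2) by metis
  define A where "A = (\<Union>i<n. \<rho> ` W i)"
  define B where "B = (\<Union>i<n. \<rho> ` V i)"
  have "card (orb x \<inter> A) = (\<Sum>i<n. card (orb x \<inter> \<sigma> ` E i))" for x
    unfolding A_def using card_orb_UN[of n W x] W Wd by simp
  moreover have "card (orb x \<inter> B) = (\<Sum>i<n. card (orb x \<inter> \<rho> ` E i))" for x
    unfolding B_def using card_orb_UN[of n V x] V Vd by simp
  ultimately have "card (orb x \<inter> A) = card (orb x \<inter> B)" for x
    using balanced_outside_K[of n C x, OF C cyc] by (simp add: E_def)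
  then have cardAB: "card (orb x \<inter> (units G - A)) = card (orb x \<inter> (units G - B))" for x
    by (simp add: card_orb_compl)
  have "compact_open \<T> (units G - A)" "compact_open \<T> (units G - B)"
    unfolding A_def B_def using W(1) V(1)
    by (auto intro!: compact_open_Diff[OF Hausdorff compact_open_units] compact_open_UN compact_open_rng
        simp: bisectionD)
  then obtain W0 where W0: "bisection W0" "W0 \<subseteq> K" "\<sigma> ` W0 = units G - A" "\<rho> ` W0 \<subseteq> units G - B"
    using K_comparison[of "units G - A" "units G - B"] cardAB by (metis Diff_subset order_refl)
  \<comment> \<open>Inside \<open>K\<close> source and range counts of \<open>W0\<close> agree in
    each orbit, so in the finite orbits the inclusion becomes an equality.\<close>
  have W0B: "\<rho> ` W0 = units G - B"
  proof
    show "units G - B \<subseteq> \<rho> ` W0"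
    proof
      fix y assume y: "y \<in> units G - B"
      have "card (orb y \<inter> \<rho> ` W0) = card (orb y \<inter> (units G - B))"
        using card_orb_bisection[of W0 y] bisectionD(2,3)[OF W0(1)] W0(2,3) cardAB by simp
      then have "orb y \<inter> \<rho> ` W0 = orb y \<inter> (units G - B)"
        using W0(4) by (intro card_subset_eq) auto
      then show "y \<in> \<rho> ` W0"
        using y orb_self[of y] by blast
    qed
  qed (rule W0(4))
  \<comment> \<open>Read from right to left: back from the range of \<open>W i\<close> to the source
    of \<open>E i\<close>, along \<open>E i\<close>, then on to the range of \<open>V i\<close>.
    Sources and ranges of the \<open>U i\<close> thus inherit the disjointness of the
    packings.\<close>
  define U where "U i = V i \<cdot> E i \<cdot> \<iota> ` W i" for i
  have U: "bisection (U i)" "\<rho> ` U i = \<rho> ` V i" "\<sigma> ` U i = \<rho> ` W i"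
    "indicator (U i) \<sim> (\<lambda>x. indicator (V i) x + indicator (E i) x - indicator (W i) x)" if i: "i < n" for i
  proof -
    note VE = bisection_mult[OF V(1)[OF i] E[OF i]] and W' = bisection_inv[OF W(1)[OF i]]
    note sub = bisectionD(1)[OF V(1)[OF i]] bisectionD(1)[OF E[OF i]] bisectionD(1)[OF W(1)[OF i]]
    note rs = rng_src_set_mult[OF sub(1,2) V(3)[OF i]]
    have m: "\<sigma> ` (V i \<cdot> E i) = \<rho> ` \<iota> ` W i"
      using rs(2) W(3)[OF i] rng_src_inv_image(1)[OF sub(3)] by simp
    show "bisection (U i)"
      unfolding U_def by (rule bisection_mult[OF VE W'])
    show "\<rho> ` U i = \<rho> ` V i" "\<sigma> ` U i = \<rho> ` W i"
      unfolding U_def using rng_src_set_mult[OF bisectionD(1)[OF VE] bisectionD(1)[OF W'] m] rs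
        rng_src_inv_image(2)[OF sub(3)] by simp_all
    have "indicator (U i) \<sim> (\<lambda>x. indicator (V i \<cdot> E i) x + indicator (\<iota> ` W i) x)"
      unfolding U_def by (rule homologous_mult[OF VE W' m])
    also have "\<dots> \<sim> (\<lambda>x. (indicator (V i) x + indicator (E i) x) + - indicator (W i) x)"
      by (rule homologous_add[OF homologous_mult[OF V(1)[OF i] E[OF i] V(3)[OF i]] homologous_inv[OF W(1)[OF i]]])
    finally show "indicator (U i) \<sim> (\<lambda>x. indicator (V i) x + indicator (E i) x - indicator (W i) x)"
      by simp
  qed
  have Ud: "disjoint_family_on (\<lambda>i. \<rho> ` U i) {..<n}" "disjoint_family_on (\<lambda>i. \<sigma> ` U i) {..<n}"
    using Vd Wd U(2,3) by (simp_all add: disjoint_family_on_def)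
  define U1 where "U1 = (\<Union>i<n. U i)"
  have U1: "bisection U1" "\<rho> ` U1 = B" "\<sigma> ` U1 = A"
    unfolding U1_def using bisection_UN[of n U, OF U(1) Ud] U(2,3) by (auto simp: A_def B_def image_UN)
  have AB: "A \<subseteq> units G" "B \<subseteq> units G"
    using bisectionD(1)[OF U1(1)] U1(2,3) by auto
  have full: "U1 \<union> W0 \<in> full_bisections G"
    unfolding full_bisections_iff
  proof (intro conjI)
    show "bisection (U1 \<union> W0)"
      using U1 W0 W0B by (intro bisection_Un) auto
    show "\<rho> ` (U1 \<union> W0) = units G" "\<sigma> ` (U1 \<union> W0) = units G"
      using U1 W0 W0B AB by (auto simp: image_Un)
  qed
  \<comment> \<open>This is the indicator of the full bisection with each \<open>U i\<close>
    expanded by the product and inverse rules; in this form it can be compared with the given sum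
    arrow by arrow.\<close>
  define p where "p = (\<lambda>x. (\<Sum>i<n. indicator (V i) x + indicator (E i) x - indicator (W i) x) + indicator W0 x :: int)"
  define c where "c = (\<lambda>x. \<Sum>i<n. indicator (C i) x :: int)"
  have ind: "indicator (U1 \<union> W0) = (\<lambda>x. (\<Sum>i<n. indicator (U i) x) + indicator W0 x :: int)"
  proof
    fix x
    have "disjoint_family_on U {..<n}"
      using Ud(1) unfolding disjoint_family_on_def by blast
    then have "indicator U1 x = (\<Sum>i<n. indicator (U i) x :: int)"
      unfolding U1_def by (simp add: indicator_UN_disjoint)
    moreover have "U1 \<inter> W0 = {}"
      using U1(2) W0B by blast
    ultimately show "indicator (U1 \<union> W0) x = (\<Sum>i<n. indicator (U i) x) + (indicator W0 x :: int)"
      by (simp add: indicator_add[symmetric])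
  qed
  have Up: "indicator (U1 \<union> W0) \<sim> p"
    unfolding ind p_def using U(4) by (intro homologous_add homologous_sum) auto
  have Cc_p: "p \<in> Cc \<T>"
    unfolding p_def
  proof (rule Cc_combine[OF Hausdorff _ Cc_bisection[OF W0(1)], of _ "(+)"])
    show "(\<lambda>x. \<Sum>i<n. indicator (V i) x + indicator (E i) x - indicator (W i) x) \<in> Cc \<T>"
    proof (rule Cc_sum[OF Hausdorff])
      fix i assume "i \<in> {..<n}"
      then have i: "indicator (V i) \<in> Cc \<T>" "indicator (E i) \<in> Cc \<T>" "indicator (W i) \<in> Cc \<T>"
        using V(1) E W(1) Cc_bisection by auto
      show "(\<lambda>x. indicator (V i) x + indicator (E i) x - indicator (W i) x) \<in> Cc \<T>"
        by (rule Cc_combine[OF Hausdorff Cc_combine[OF Hausdorff i(1,2), of "(+)"] i(3), of "(-)"]) auto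
    qed
  qed simp
  have Cc_c: "c \<in> Cc \<T>"
    unfolding c_def using C Cc_bisection by (intro Cc_sum[OF Hausdorff]) auto
  have "(\<lambda>x. p x - c x) \<in> boundaries1 G"
  proof (rule K_cycle_boundary)
    show "(\<lambda>x. p x - c x) \<in> Cc \<T>"
      by (rule Cc_combine[OF Hausdorff Cc_p Cc_c, of "(-)"]) simp
    show "p g - c g = 0" if g: "g \<notin> K" for g
    proof -
      \<comment> \<open>Off \<open>K\<close> only the term of \<open>E i\<close> survives, and there
        it agrees with \<open>C i\<close>.\<close>
      have "indicator (V i) g + indicator (E i) g - indicator (W i) g = (indicator (C i) g :: int)" if "i < n" for i
        using V(2)[OF that] W(2)[OF that] g by (auto simp: E_def indicator_def)
      moreover have "indicator W0 g = (0 :: int)"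
        using W0(2) g by (auto simp: indicator_def)
      ultimately show ?thesis
        by (simp add: p_def c_def)
    qed
    show "delta1 G (\<lambda>x. p x - c x) x = 0" if x: "x \<in> units G" for x
    proof -
      \<comment> \<open>The cycle condition passes to \<open>p\<close> from the full bisection,
        whose source and range both fill the units.\<close>
      have "delta1 G p x = delta1 G (indicator (U1 \<union> W0)) x"
        using delta1_homologous[OF _ Cc_p Up] full
        by (simp add: full_bisections_iff Cc_bisection)
      also have "\<dots> = 0"
        using full x by (simp add: full_bisections_iff delta1_indicator)
      finally have "delta1 G p x = 0" .
      moreover have "delta1 G c x = (\<Sum>i<n. indicator (\<sigma> ` C i) x - indicator (\<rho> ` C i) x)"
        unfolding c_def using C by (subst delta1_sum) (auto simp: Cc_bisection delta1_indicator)
      ultimately show ?thesis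
        using cyc[OF x] by (simp add: delta1_diff[OF Cc_p Cc_c] sum_subtractf)
    qed
  qed
  then have "p \<sim> c"
    by (simp add: homologous_def)
  then show thesis
    using that[OF full] homologous_trans[OF Up] by (simp add: c_def)
qed

text \<open>This links orbit counts to the quantity bounded by almost finiteness. A source
  \<open>y\<close> in the orbit, with \<open>c\<close> in \<open>U - K\<close> and \<open>k\<close>
  in \<open>K\<close> from \<open>x\<close> to \<open>y\<close>, gives \<open>c \<odot> k\<close>
  outside \<open>K\<close>; its range is that of \<open>c\<close>, which determines \<open>c\<close>
  in the bisection \<open>U\<close> and hence \<open>y\<close>.\<close>

lemma card_orb_outside_le:
  assumes U: "bisection U" "U \<subseteq> C" and C: "compactin \<T> C"
  shows "card (orb x \<inter> \<sigma> ` (U - K))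
    \<le> card ({c \<odot> k | c k. c \<in> C \<and> k \<in> {k \<in> K. \<sigma> k = x} \<and> \<sigma> c = \<rho> k} - {k \<in> K. \<sigma> k = x})"
    (is "_ \<le> card (?CK - ?Kx)")
proof (rule surj_card_le)
  have "finite ?Kx"
    using finite_fibre(2) K_compact_open by (simp add: compact_open_def)
  then have "finite (\<Union>k\<in>?Kx. (\<lambda>c. c \<odot> k) ` {c \<in> C. \<sigma> c = \<rho> k})"
    using finite_fibre(2)[OF C] by simp
  then have "finite ?CK"
    by (rule rev_finite_subset) blast
  then show "finite (?CK - ?Kx)" by simp
  show "orb x \<inter> \<sigma> ` (U - K) \<subseteq> (\<lambda>g. \<sigma> (the_inv_into U \<rho> (\<rho> g))) ` (?CK - ?Kx)"
  proof
    fix y assume "y \<in> orb x \<inter> \<sigma> ` (U - K)"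
    then obtain k c where k: "k \<in> K" "\<sigma> k = x" "\<rho> k = y" and c: "c \<in> U" "c \<notin> K" "\<sigma> c = y"
      by (auto elim: orbE)
    have c\<Gamma>: "c \<in> \<Gamma>"
      using c bisectionD(1)[OF U(1)] by auto
    have "c \<odot> k \<notin> K"
    proof
      assume "c \<odot> k \<in> K"
      then have "c \<odot> k \<odot> \<iota> k \<in> K"
        using k c c\<Gamma> K_inv by (intro K_mult[of "c \<odot> k"]) auto
      then show False
        using c k c\<Gamma> by simp
    qed
    moreover have "c \<odot> k \<in> ?CK"
      using c k U(2) by (intro CollectI exI[of _ c] exI[of _ k]) auto
    moreover have "the_inv_into U \<rho> (\<rho> (c \<odot> k)) = c"
      using c k c\<Gamma> bisectionD(2)[OF U(1)] by (simp add: the_inv_into_f_f)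
    ultimately show "y \<in> (\<lambda>g. \<sigma> (the_inv_into U \<rho> (\<rho> g))) ` (?CK - ?Kx)"
      using c by (intro image_eqI[of _ _ "c \<odot> k"]) auto
  qed
qed

end

theorem theorem7p5:
  fixes G :: "'a groupoid"
  assumes "etale_groupoid G"
    and "second_countable (gtop G)"
    and "essentially_principal G"
    and "compact_space (unit_top G)"
    and "totally_disconnected_space (unit_top G)"
    and "almost_finite G"
  shows "index_map G ` full_group G = H1 G"
proof -
  interpret ample_groupoid G
    using assms by unfold_locales
  have "hclass G f \<in> (\<lambda>U. hclass G (indicator U)) ` full_bisections G" if f: "f \<in> cycles1 G" for f
  proof -
    have fC: "f \<in> Cc \<T>" and f0: "\<And>x. x \<in> units G \<Longrightarrow> delta1 G f x = 0"
      using f by (auto simp: cycles1_def)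
    obtain Cs where Cs: "\<forall>C\<in>set Cs. bisection C" "f \<sim> (\<lambda>x. \<Sum>C\<leftarrow>Cs. indicator C x)"
      using Cc_bisection_sum[OF fC] by (auto simp: bisection_sum_def)
    define n where "n = length Cs"
    define C where "C i = Cs ! i" for i
    have C: "bisection (C i)" if "i < n" for i
      using that Cs(1) by (simp add: C_def n_def)
    have fc: "f \<sim> (\<lambda>x. \<Sum>i<n. indicator (C i) x)"
      using Cs(2) by (simp add: C_def n_def sum_list_sum_nth atLeast0LessThan)
    have cyc: "(\<Sum>i<n. indicator (\<sigma> ` C i) x) = (\<Sum>i<n. indicator (\<rho> ` C i) x :: int)" if x: "x \<in> units G" for x
    proof -
      have "(\<lambda>x. \<Sum>i<n. indicator (C i) x) \<in> Cc \<T>"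
        using C Cc_bisection by (intro Cc_sum[OF Hausdorff]) auto
      then have "delta1 G (\<lambda>x. \<Sum>i<n. indicator (C i) x) x = 0"
        using delta1_homologous[OF fC _ fc] f0[OF x] by simp
      moreover have "delta1 G (\<lambda>x. \<Sum>i<n. indicator (C i) x) x
          = (\<Sum>i<n. indicator (\<sigma> ` C i) x - indicator (\<rho> ` C i) x)"
        using C by (subst delta1_sum) (auto simp: Cc_bisection delta1_indicator)
      ultimately show ?thesis
        by (simp add: sum_subtractf)
    qed
    \<comment> \<open>One compact set contains all the \<open>C i\<close>, so a single boundary
      count bounds the contribution of each.\<close>
    define D where "D = (\<Union>i<n. C i)"
    have D: "compactin \<T> D"
      using compact_open_UN[of "{..<n}" \<T> C] C bisectionD(4) by (auto simp: D_def compact_open_def)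
    \<comment> \<open>The tolerance \<open>1 / real (Suc n)\<close> is positive even for
      \<open>n = 0\<close>, and \<open>n\<close> counts below that fraction of an orbit still fit
      into it together.\<close>
    obtain K where K: "elementary_subgroupoid G K"
      and Folner: "\<And>x. x \<in> units G \<Longrightarrow>
        real (card ({c \<odot> k | c k. c \<in> D \<and> k \<in> {k \<in> K. \<sigma> k = x} \<and> \<sigma> c = \<rho> k} - {k \<in> K. \<sigma> k = x}))
          / real (card (\<rho> ` {k \<in> K. \<sigma> k = x})) < 1 / real (Suc n)"
      using assms(6)[unfolded almost_finite_def Let_def, rule_format, of D "1 / real (Suc n)"] D
      by auto
    interpret elementary G K
      using K by unfold_locales
    have small: "(\<Sum>i<n. card (orb x \<inter> \<sigma> ` (C i - K))) \<le> card (orb x)" if x: "x \<in> units G" for x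
    proof -
      define m where "m = card ({c \<odot> k | c k. c \<in> D \<and> k \<in> {k \<in> K. \<sigma> k = x} \<and> \<sigma> c = \<rho> k} - {k \<in> K. \<sigma> k = x})"
      have "card (orb x \<inter> \<sigma> ` (C i - K)) \<le> m" if "i < n" for i
        unfolding m_def using that D C by (intro card_orb_outside_le) (auto simp: D_def)
      then have "(\<Sum>i<n. card (orb x \<inter> \<sigma> ` (C i - K))) \<le> n * m"
        using sum_bounded_above[of "{..<n}" "\<lambda>i. card (orb x \<inter> \<sigma> ` (C i - K))" m] by simp
      \<comment> \<open>Positivity is what allows the denominator to be cleared, since division by 0
        gives 0 in HOL.\<close>
      moreover have "0 < card (orb x)"
        using orb_self[OF x] by (auto simp: card_gt_0_iff)
      moreover from this have "real m * real (Suc n) < real (card (orb x))"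
        using Folner[OF x] by (simp add: m_def orb_def field_simps)
      then have "m * Suc n < card (orb x)"
        by (metis of_nat_less_iff of_nat_mult)
      ultimately show ?thesis
        by (simp add: algebra_simps)
    qed
    obtain U where U: "U \<in> full_bisections G" "indicator U \<sim> (\<lambda>x. \<Sum>i<n. indicator (C i) x)"
      using full_bisection_of_small_sum[of n C, OF C cyc small] by blast
    have "hclass G f = hclass G (indicator U)"
      by (rule hclass_eqI[OF homologous_trans[OF fc homologous_sym[OF U(2)]]])
    then show ?thesis
      using U(1) by blast
  qed
  \<comment> \<open>The opposite inclusion holds because the indicator of a full bisection is a
    cycle.\<close>
  then show ?thesis
    unfolding index_map_image H1_def using indicator_full_bisection_cycle by blast
qed

end
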